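(* For each $n\ge1$, $SH_n=\sum_{(p,\overline{\sigma})\in\mathrm{Gar}(n)}R_{\lambda(p)}$.
   Context: Parking functions: an $n$-tuple $p$ of positive integers whose $i$-th smallest entry is at most $i$ for each $i$; $\mathrm{Pf}(n)$ their set; $p$ sorted if weakly increasing; $\alpha_k(p)=\#\{j:p_j=k\}$; $\lambda(p)$ the partition formed by the nonzero $\alpha_k(p)$. A sorted naive shifted parking function of size $n$ is a pair $(p,\overline{\sigma})$ with $p\in\mathrm{Pf}(n)$ sorted and $\overline{\sigma}\in\{-1,0,1\}^n$ with $\overline{\sigma}_k=0$ iff $\alpha_k(p)=0$. Let $\upsilon_i=0,1,2$ according as $\alpha_i(p)=0$, $\alpha_i(p)$ odd, or $\alpha_i(p)>0$ even. $(p,\overline{\sigma})$ is a garage if for all $i<j$ with $\upsilon_i=\upsilon_j=2$ such that every prefix of the word $\upsilon_{i+1}\cdots\upsilon_{j-1}$ has at least as many $2$'s as $0$'s, $\overline{\sigma}_i=\overline{\sigma}_j$. $\mathrm{Gar}(n)$ is the set of garages of size $n$. Symmetric functions: $h_k,e_k,p_k$ complete homogeneous, elementary, power sums; $P_0=1$, $P_k=\frac12\sum_{i=0}^kh_ie_{k-i}$ for $k\geq 1$; $R_m=P_m$ for $m$ odd and $R_m=\sum_{i=1}^{m/2}P_{2i}P_{m-2i}$ for $m$ even; $R_\lambda=\prod_iR_{\lambda_i}$. $\mathtt{sh}$ is the algebra endomorphism of $\mathrm{Sym}$ with $p_{2k-1}\mapsto2p_{2k-1}$, $p_{2k}\mapsto0$;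 $PF_n=\sum h_{\lambda(p)}$ over sorted $p\in\mathrm{Pf}(n)$; $SH_n=\mathtt{sh}(PF_n)$. *)

theory Defs
  imports Complex_Main "HOL-Library.Poly_Mapping" "HOL-Library.Multiset" "HOL-Library.Sublist"
begin

section \<open>The ring of symmetric functions over the rationals\<close>

text \<open>
  A monomial in the variables \<open>x\<^sub>0, x\<^sub>1, \<dots>\<close> is a finitely supported exponent vector, and a formal
  power series is the function sending a monomial to its coefficient.
\<close>

type_synonym mono = "nat \<Rightarrow>\<^sub>0 nat"

definition mono_deg :: "mono \<Rightarrow> nat" where
  "mono_deg m = (\<Sum>i\<in>Poly_Mapping.keys m. Poly_Mapping.lookup m i)"

definition splits :: "mono \<Rightarrow> (mono \<times> mono) set" where
  "splits m = {(a, b). a + b = m}"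

text \<open>For a bijection \<open>\<pi>\<close>, \<open>map_key \<pi> m\<close> has exponent vector \<open>lookup m \<circ> \<pi>\<close>.\<close>

definition symmetric_series :: "(mono \<Rightarrow> rat) \<Rightarrow> bool" where
  "symmetric_series f \<longleftrightarrow> (\<forall>\<pi> m. bij \<pi> \<longrightarrow> f (Poly_Mapping.map_key \<pi> m) = f m)"

definition bounded_degree :: "(mono \<Rightarrow> rat) \<Rightarrow> bool" where
  "bounded_degree f \<longleftrightarrow> (\<exists>d. \<forall>m. mono_deg m > d \<longrightarrow> f m = 0)"

lemma lookup_le_mono_deg: "Poly_Mapping.lookup m i \<le> mono_deg m"
proof (cases "i \<in> Poly_Mapping.keys m")
  case True
  then show ?thesis unfolding mono_deg_def by (intro member_le_sum) auto
next
  case False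
  then show ?thesis by (simp add: in_keys_iff)
qed

lemma mono_deg_superset:
  assumes "finite A" "Poly_Mapping.keys m \<subseteq> A"
  shows "mono_deg m = (\<Sum>i\<in>A. Poly_Mapping.lookup m i)"
  unfolding mono_deg_def using assms
  by (intro sum.mono_neutral_left) (auto simp: in_keys_iff)

lemma mono_deg_plus: "mono_deg (a + b) = mono_deg a + mono_deg b"
proof -
  let ?A = "Poly_Mapping.keys a \<union> Poly_Mapping.keys b"
  have "mono_deg (a + b) = (\<Sum>i\<in>?A. Poly_Mapping.lookup (a + b) i)"
    using Poly_Mapping.keys_add[of a b] by (intro mono_deg_superset) auto
  also have "\<dots> = mono_deg a + mono_deg b"
    by (simp add: lookup_add sum.distrib mono_deg_superset[of ?A a] mono_deg_superset[of ?A b])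
  finally show ?thesis .
qed

lemma mono_deg_zero [simp]: "mono_deg 0 = 0"
  by (simp add: mono_deg_def)

lemma mono_deg_single [simp]: "mono_deg (Poly_Mapping.single i k) = k"
  by (simp add: mono_deg_def)

lemma keys_map_key_bij:
  assumes "bij \<pi>"
  shows "Poly_Mapping.keys (Poly_Mapping.map_key \<pi> m) = \<pi> -` Poly_Mapping.keys m"
  using assms by (auto simp: in_keys_iff map_key.rep_eq bij_is_inj)

lemma lookup_map_key_bij:
  "bij \<pi> \<Longrightarrow> Poly_Mapping.lookup (Poly_Mapping.map_key \<pi> m) i = Poly_Mapping.lookup m (\<pi> i)"
  by (simp add: map_key.rep_eq bij_is_inj)

lemma mono_deg_map_key:
  assumes "bij \<pi>"
  shows "mono_deg (Poly_Mapping.map_key \<pi> m) = mono_deg m"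
proof -
  have "\<pi> ` (\<pi> -` Poly_Mapping.keys m) = Poly_Mapping.keys m"
    using assms by (simp add: bij_is_surj surj_image_vimage_eq)
  moreover have "inj_on \<pi> (\<pi> -` Poly_Mapping.keys m)"
    using assms by (meson bij_is_inj inj_on_subset subset_UNIV)
  ultimately have "bij_betw \<pi> (\<pi> -` Poly_Mapping.keys m) (Poly_Mapping.keys m)"
    by (simp add: bij_betw_def)
  from sum.reindex_bij_betw[OF this, of "Poly_Mapping.lookup m"] show ?thesis
    using assms by (simp add: mono_deg_def keys_map_key_bij lookup_map_key_bij)
qed

lemma map_key_plus_bij:
  assumes "bij \<pi>"
  shows "Poly_Mapping.map_key \<pi> (a + b) = Poly_Mapping.map_key \<pi> a + Poly_Mapping.map_key \<pi> b"
  using assms by (intro poly_mapping_eqI) (simp add: lookup_map_key_bij lookup_add)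

lemma map_key_zero_bij: "bij \<pi> \<Longrightarrow> Poly_Mapping.map_key \<pi> 0 = 0"
  by (intro poly_mapping_eqI) (simp add: lookup_map_key_bij)

lemma map_key_inv_bij:
  assumes "bij \<pi>"
  shows "Poly_Mapping.map_key \<pi> (Poly_Mapping.map_key (inv \<pi>) m) = m"
    and "Poly_Mapping.map_key (inv \<pi>) (Poly_Mapping.map_key \<pi> m) = m"
  using assms
  by (auto intro!: poly_mapping_eqI
      simp: lookup_map_key_bij bij_imp_bij_inv bij_is_inj bij_is_surj surj_f_inv_f)

lemma finite_splits [simp]: "finite (splits m)"
proof -
  let ?D = "{a :: mono. \<forall>i. Poly_Mapping.lookup a i \<le> Poly_Mapping.lookup m i}"
  let ?F = "{f. \<forall>i. (i \<in> Poly_Mapping.keys m \<longrightarrow> f i \<in> {..mono_deg m}) \<and>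
                    (i \<notin> Poly_Mapping.keys m \<longrightarrow> f i = (0::nat))}"
  have "finite ?F"
    by (intro finite_set_of_finite_funs) auto
  moreover have "Poly_Mapping.lookup ` ?D \<subseteq> ?F"
  proof (intro subsetI CollectI allI conjI impI)
    fix f i assume "f \<in> Poly_Mapping.lookup ` ?D"
    then have *: "f i \<le> Poly_Mapping.lookup m i" by auto
    then show "f i \<in> {..mono_deg m}"
      using lookup_le_mono_deg[of m i] by simp
    show "f i = 0" if "i \<notin> Poly_Mapping.keys m"
      using * that by (simp add: in_keys_iff)
  qed
  ultimately have "finite (Poly_Mapping.lookup ` ?D)"
    by (rule finite_subset[rotated])
  then have "finite ?D"
    by (rule finite_imageD) (auto intro!: inj_onI poly_mapping_eqI)
  moreover have "splits m \<subseteq> ?D \<times> ?D"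
    by (auto simp: splits_def lookup_add)
  ultimately show ?thesis
    by (meson finite_SigmaI finite_subset)
qed

lemma splits_map_key:
  assumes "bij \<pi>"
  shows "bij_betw (map_prod (Poly_Mapping.map_key \<pi>) (Poly_Mapping.map_key \<pi>))
           (splits m) (splits (Poly_Mapping.map_key \<pi> m))"
  by (rule bij_betw_byWitness
      [where f' = "map_prod (Poly_Mapping.map_key (inv \<pi>)) (Poly_Mapping.map_key (inv \<pi>))"])
    (auto simp: splits_def map_key_plus_bij[OF assms, symmetric] map_key_inv_bij[OF assms]
      map_key_plus_bij[OF bij_imp_bij_inv[OF assms], symmetric])

typedef sym = "{f :: mono \<Rightarrow> rat. symmetric_series f \<and> bounded_degree f}"
  morphisms coeff_sym Abs_sym
  by (rule exI[of _ "\<lambda>_. 0"]) (auto simp: symmetric_series_def bounded_degree_def)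

setup_lifting type_definition_sym

instantiation sym :: comm_ring_1
begin

lift_definition zero_sym :: sym is "\<lambda>_. 0"
  by (auto simp: symmetric_series_def bounded_degree_def)

lift_definition one_sym :: sym is "\<lambda>m. if m = 0 then 1 else 0"
proof -
  have "Poly_Mapping.map_key \<pi> m = 0 \<longleftrightarrow> m = 0" if "bij \<pi>" for \<pi> :: "nat \<Rightarrow> nat" and m :: mono
    by (metis that bij_imp_bij_inv map_key_inv_bij(2) map_key_zero_bij)
  then show "symmetric_series (\<lambda>m. if m = 0 then 1 else 0) \<and> bounded_degree (\<lambda>m. if m = 0 then 1 else 0)"
    by (auto simp: symmetric_series_def bounded_degree_def intro!: exI[of _ 0])
qed

lift_definition plus_sym :: "sym \<Rightarrow> sym \<Rightarrow> sym" is "\<lambda>f g m. f m + g m"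
proof -
  fix f g :: "mono \<Rightarrow> rat"
  assume *: "symmetric_series f \<and> bounded_degree f" "symmetric_series g \<and> bounded_degree g"
  then obtain d d' where "\<forall>m. mono_deg m > d \<longrightarrow> f m = 0" "\<forall>m. mono_deg m > d' \<longrightarrow> g m = 0"
    by (auto simp: bounded_degree_def)
  then have "\<forall>m. mono_deg m > max d d' \<longrightarrow> f m + g m = 0"
    by auto
  then show "symmetric_series (\<lambda>m. f m + g m) \<and> bounded_degree (\<lambda>m. f m + g m)"
    using * unfolding symmetric_series_def bounded_degree_def by (intro conjI exI[of _ "max d d'"]) auto
qed

lift_definition uminus_sym :: "sym \<Rightarrow> sym" is "\<lambda>f m. - f m"
  by (auto simp: symmetric_series_def bounded_degree_def)

definition minus_sym :: "sym \<Rightarrow> sym \<Rightarrow> sym" where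
  "minus_sym f g = f + - g"

lift_definition times_sym :: "sym \<Rightarrow> sym \<Rightarrow> sym" is
  "\<lambda>f g m. \<Sum>(a, b)\<in>splits m. f a * g b"
proof -
  fix f g :: "mono \<Rightarrow> rat"
  assume *: "symmetric_series f \<and> bounded_degree f" "symmetric_series g \<and> bounded_degree g"
  let ?h = "\<lambda>m. \<Sum>(a, b)\<in>splits m. f a * g b"
  from * obtain d d' where d: "\<forall>m. mono_deg m > d \<longrightarrow> f m = 0" "\<forall>m. mono_deg m > d' \<longrightarrow> g m = 0"
    by (auto simp: bounded_degree_def)
  have "?h m = 0" if "mono_deg m > d + d'" for m
  proof (intro sum.neutral ballI, clarify)
    fix a b assume "(a, b) \<in> splits m"
    then have "mono_deg a + mono_deg b > d + d'"
      using that by (auto simp: splits_def mono_deg_plus)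
    then have "mono_deg a > d \<or> mono_deg b > d'"
      by linarith
    then show "f a * g b = 0"
      using d by auto
  qed
  then have "bounded_degree ?h"
    by (auto simp: bounded_degree_def)
  moreover have "?h (Poly_Mapping.map_key \<pi> m) = ?h m" if "bij \<pi>" for \<pi> m
    using sum.reindex_bij_betw[OF splits_map_key[OF that], of "\<lambda>(a, b). f a * g b" m] * that
    by (simp add: symmetric_series_def case_prod_unfold)
  ultimately show "symmetric_series ?h \<and> bounded_degree ?h"
    by (auto simp: symmetric_series_def)
qed

instance
proof
  fix f g h :: sym
  show "f * g * h = f * (g * h)"
  proof (transfer, rule ext)
    fix f g h :: "mono \<Rightarrow> rat" and m
    have "(\<Sum>(a, b)\<in>splits m. (\<Sum>(c, d)\<in>splits a. f c * g d) * h b)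
        = (\<Sum>x\<in>splits m. \<Sum>y\<in>splits (fst x). f (fst y) * g (snd y) * h (snd x))"
      by (simp add: case_prod_unfold sum_distrib_right)
    also have "\<dots> = (\<Sum>(x, y)\<in>(SIGMA x:splits m. splits (fst x)). f (fst y) * g (snd y) * h (snd x))"
      by (subst sum.Sigma) auto
    also have "\<dots> = (\<Sum>(x, y)\<in>(SIGMA x:splits m. splits (snd x)). f (fst x) * (g (fst y) * h (snd y)))"
      by (rule sum.reindex_bij_witness
          [where j = "\<lambda>((a, b), (c, d)). ((c, d + b), (d, b))"
             and i = "\<lambda>((a, b), (c, d)). ((a + c, d), (a, c))"])
        (auto simp: splits_def add.assoc mult.assoc)
    also have "\<dots> = (\<Sum>x\<in>splits m. \<Sum>y\<in>splits (snd x). f (fst x) * (g (fst y) * h (snd y)))"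
      by (subst sum.Sigma) auto
    also have "\<dots> = (\<Sum>(a, b)\<in>splits m. f a * (\<Sum>(c, d)\<in>splits b. g c * h d))"
      by (simp add: case_prod_unfold sum_distrib_left)
    finally show "(\<Sum>(a, b)\<in>splits m. (\<Sum>(c, d)\<in>splits a. f c * g d) * h b)
        = (\<Sum>(a, b)\<in>splits m. f a * (\<Sum>(c, d)\<in>splits b. g c * h d))" .
  qed
  show "f * g = g * f"
  proof (transfer, rule ext)
    fix f g :: "mono \<Rightarrow> rat" and m
    show "(\<Sum>(a, b)\<in>splits m. f a * g b) = (\<Sum>(a, b)\<in>splits m. g a * f b)"
      by (rule sum.reindex_bij_witness[where i = prod.swap and j = prod.swap])
        (auto simp: splits_def add.commute mult.commute)
  qed
  show "1 * f = f"
  proof (transfer, rule ext)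
    fix f :: "mono \<Rightarrow> rat" and m
    have "(\<Sum>(a, b)\<in>splits m. (if a = 0 then 1 else 0) * f b)
        = (\<Sum>(a, b)\<in>{(0 :: mono, m)}. (if a = 0 then 1 else 0) * f b)"
      by (rule sum.mono_neutral_right[OF finite_splits]) (auto simp: splits_def split: if_splits)
    then show "(\<Sum>(a, b)\<in>splits m. (if a = 0 then 1 else 0) * f b) = f m"
      by simp
  qed
  show "(f + g) * h = f * h + g * h"
    by transfer (auto simp: algebra_simps sum.distrib case_prod_unfold)
  show "f + g + h = f + (g + h)" "f + g = g + f" "0 + f = f" "- f + f = 0"
    by (transfer; simp add: algebra_simps)+
  show "f - g = f + - g"
    by (simp add: minus_sym_def)
  show "(0::sym) \<noteq> 1"
    by transfer (metis zero_neq_one)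
qed

end

lift_definition sym_scale :: "rat \<Rightarrow> sym \<Rightarrow> sym" is "\<lambda>c f m. c * f m"
  by (auto simp: symmetric_series_def bounded_degree_def)

lemma vector_space_sym_scale: "vector_space sym_scale"
  by unfold_locales (transfer; simp add: algebra_simps)+

lemma sym_scale_mult: "sym_scale c (f * g) = sym_scale c f * g"
  by transfer (simp add: sum_distrib_left case_prod_unfold mult.assoc)


section \<open>Standard symmetric functions\<close>

lift_definition sym_h :: "nat \<Rightarrow> sym" is "\<lambda>k m. if mono_deg m = k then 1 else 0"
  by (auto simp: symmetric_series_def bounded_degree_def mono_deg_map_key)

lift_definition sym_e :: "nat \<Rightarrow> sym" is
  "\<lambda>k m. if mono_deg m = k \<and> (\<forall>i. Poly_Mapping.lookup m i \<le> 1) then 1 else 0"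
proof -
  fix k :: nat
  have "(\<forall>i. Poly_Mapping.lookup m (\<pi> i) \<le> 1) \<longleftrightarrow> (\<forall>i. Poly_Mapping.lookup m i \<le> 1)"
    if "bij \<pi>" for \<pi> and m :: mono
    using that by (metis bij_pointE)
  then show "symmetric_series (\<lambda>m. if mono_deg m = k \<and> (\<forall>i. Poly_Mapping.lookup m i \<le> 1) then 1 else 0)
      \<and> bounded_degree (\<lambda>m. if mono_deg m = k \<and> (\<forall>i. Poly_Mapping.lookup m i \<le> 1) then 1 else 0)"
    by (auto simp: symmetric_series_def bounded_degree_def mono_deg_map_key lookup_map_key_bij)
qed

text \<open>Only meant for \<open>k \<ge> 1\<close>; at \<open>k = 0\<close> this is the constant 1.\<close>

lift_definition sym_p :: "nat \<Rightarrow> sym" is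
  "\<lambda>k m. if \<exists>i. m = Poly_Mapping.single i k then 1 else 0"
proof -
  fix k :: nat
  have *: "\<exists>i. Poly_Mapping.map_key \<pi> m = Poly_Mapping.single i k"
    if "bij \<pi>" "\<exists>i. m = Poly_Mapping.single i k" for \<pi> :: "nat \<Rightarrow> nat" and m
  proof -
    from that obtain i where i: "m = Poly_Mapping.single i k" by auto
    have "Poly_Mapping.map_key \<pi> m = Poly_Mapping.single (inv \<pi> i) k"
      using that(1) unfolding i
      by (intro poly_mapping_eqI)
        (auto simp: lookup_map_key_bij lookup_single when_def bij_is_inj surj_f_inv_f[OF bij_is_surj])
    then show ?thesis by auto
  qed
  then have "(\<exists>i. Poly_Mapping.map_key \<pi> m = Poly_Mapping.single i k) \<longleftrightarrow> (\<exists>i. m = Poly_Mapping.single i k)"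
    if "bij \<pi>" for \<pi> :: "nat \<Rightarrow> nat" and m :: mono
    using that *[OF bij_imp_bij_inv[OF that], of "Poly_Mapping.map_key \<pi> m"]
    by (metis map_key_inv_bij(2))
  then show "symmetric_series (\<lambda>m. if \<exists>i. m = Poly_Mapping.single i k then 1 else 0)
      \<and> bounded_degree (\<lambda>m. if \<exists>i. m = Poly_Mapping.single i k then 1 else 0)"
    by (auto simp: symmetric_series_def bounded_degree_def intro!: exI[of _ k])
qed

definition sym_P :: "nat \<Rightarrow> sym" where
  "sym_P k = (if k = 0 then 1 else sym_scale (1/2) (\<Sum>i=0..k. sym_h i * sym_e (k - i)))"

definition sym_R :: "nat \<Rightarrow> sym" where
  "sym_R m = (if odd m then sym_P m else (\<Sum>i=1..m div 2. sym_P (2 * i) * sym_P (m - 2 * i)))"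

text \<open>Partitions are represented by the multiset of their parts.\<close>

definition h_part :: "nat multiset \<Rightarrow> sym" where
  "h_part l = (\<Prod>k\<in>#l. sym_h k)"

definition R_part :: "nat multiset \<Rightarrow> sym" where
  "R_part l = (\<Prod>k\<in>#l. sym_R k)"

definition sym_alg_endo :: "(sym \<Rightarrow> sym) \<Rightarrow> bool" where
  "sym_alg_endo \<phi> \<longleftrightarrow> Vector_Spaces.linear sym_scale sym_scale \<phi> \<and>
     \<phi> 1 = 1 \<and> (\<forall>f g. \<phi> (f * g) = \<phi> f * \<phi> g)"

text \<open>
  The power sums \<open>sym_p k\<close>, \<open>k \<ge> 1\<close>, freely generate the rational algebra \<open>sym\<close>, so exactly one
  function satisfies the following predicate.
\<close>

definition is_sh :: "(sym \<Rightarrow> sym) \<Rightarrow> bool" where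
  "is_sh sh \<longleftrightarrow> sym_alg_endo sh \<and>
     (\<forall>k\<ge>1. sh (sym_p (2 * k - 1)) = sym_scale 2 (sym_p (2 * k - 1)) \<and> sh (sym_p (2 * k)) = 0)"


section \<open>Parking functions and garages\<close>

text \<open>An \<open>n\<close>-tuple is a list of length \<open>n\<close>, so its \<open>k\<close>-th entry is the list element at index \<open>k - 1\<close>.\<close>

definition Pf :: "nat \<Rightarrow> nat list set" where
  "Pf n = {p. length p = n \<and> (\<forall>x\<in>set p. x \<ge> 1) \<and> (\<forall>i\<in>{1..n}. sort p ! (i - 1) \<le> i)}"

definition alpha :: "nat list \<Rightarrow> nat \<Rightarrow> nat" where
  "alpha p k = card {j \<in> {1..length p}. p ! (j - 1) = k}"

definition lam :: "nat list \<Rightarrow> nat multiset" where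
  "lam p = image_mset (alpha p) (mset_set {k. alpha p k \<noteq> 0})"

definition PF :: "nat \<Rightarrow> sym" where
  "PF n = (\<Sum>p\<in>{p \<in> Pf n. sorted p}. h_part (lam p))"

definition naive_shifted_pf :: "nat \<Rightarrow> (nat list \<times> int list) set" where
  "naive_shifted_pf n = {(p, \<sigma>). p \<in> Pf n \<and> sorted p \<and> length \<sigma> = n \<and> set \<sigma> \<subseteq> {-1, 0, 1} \<and>
     (\<forall>k\<in>{1..n}. \<sigma> ! (k - 1) = 0 \<longleftrightarrow> alpha p k = 0)}"

definition upsilon :: "nat list \<Rightarrow> nat \<Rightarrow> nat" where
  "upsilon p i = (if alpha p i = 0 then 0 else if odd (alpha p i) then 1 else 2)"

definition Gar :: "nat \<Rightarrow> (nat list \<times> int list) set" where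
  "Gar n = {(p, \<sigma>) \<in> naive_shifted_pf n.
     \<forall>i\<in>{1..n}. \<forall>j\<in>{1..n}. i < j \<and> upsilon p i = 2 \<and> upsilon p j = 2 \<and>
       (\<forall>w. prefix w (map (upsilon p) [i + 1..<j]) \<longrightarrow> count_list w 2 \<ge> count_list w 0)
       \<longrightarrow> \<sigma> ! (i - 1) = \<sigma> ! (j - 1)}"

lemma finite_Pf: "finite (Pf n)"
proof -
  have "Pf n \<subseteq> {p. set p \<subseteq> {..n} \<and> length p = n}"
  proof (intro subsetI CollectI conjI)
    fix p x assume p: "p \<in> Pf n"
    then show "length p = n" by (simp add: Pf_def)
    assume "x \<in> set p"
    then have "x \<in> set (sort p)" by simp
    then obtain i where "i < n" "sort p ! i = x"
      using p by (metis (mono_tags, lifting) Pf_def in_set_conv_nth length_sort mem_Collect_eq)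
    then show "x \<in> {..n}"
      using p by (auto simp: Pf_def dest!: bspec[of _ _ "Suc i"])
  qed
  then show ?thesis
    using finite_lists_length_eq[of "{..n}" n] by (rule finite_subset) auto
qed

lemma finite_Gar: "finite (Gar n)"
proof -
  have "Gar n \<subseteq> Pf n \<times> {\<sigma>. set \<sigma> \<subseteq> {-1, 0, 1} \<and> length \<sigma> = n}"
    by (auto simp: Gar_def naive_shifted_pf_def)
  then show ?thesis
    using finite_Pf finite_lists_length_eq[of "{-1, 0, 1 :: int}" n]
    by (meson finite.emptyI finite.insertI finite_SigmaI finite_subset)
qed

lemma finite_alpha_support: "finite {k. alpha p k \<noteq> 0}"
proof (rule finite_subset)
  show "{k. alpha p k \<noteq> 0} \<subseteq> set p"
  proof clarify
    fix k assume "0 < alpha p k"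
    then obtain j where "j \<in> {1..length p}" "p ! (j - 1) = k"
      unfolding alpha_def by (metis (mono_tags, lifting) card_gt_0_iff ex_in_conv mem_Collect_eq)
    then show "k \<in> set p" by (auto simp: in_set_conv_nth intro!: exI[of _ "j - 1"])
  qed
qed simp

end

theory Submission
  imports Defs "HOL-Computational_Algebra.Formal_Power_Series"
begin

text \<open>
  By Newton's identities \<open>sh\<close> sends \<open>h\<^sub>k\<close> to \<open>q\<^sub>k = \<Sum>\<^sub>i h\<^sub>i e\<^bsub>k - i\<^esub>\<close>, so with \<open>\<alpha>\<close> ranging over the
  content words of sorted parking functions (Lukasiewicz words) the left side is
  \<open>\<Sum>\<^sub>\<alpha> \<Prod>\<^sub>k q\<^bsub>\<alpha>\<^sub>k\<^esub>\<close>. On the right, the signs of a word are counted by reading it from left to right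
  with a counter \<open>d\<close> of even letters not yet closed by a \<open>0\<close>: an odd letter has two signs, an even
  letter has two signs if \<open>d = 0\<close> and otherwise the sign of the open ones.

  Let \<open>y(t) = \<Sum>\<^sub>i P\<^bsub>2i\<^esub> t\<^bsup>2i\<^esup>\<close>, \<open>x = 1/y\<close>, \<open>a(t) = \<Sum> 2 R\<^sub>m t\<^sup>m\<close> over odd \<open>m\<close> and \<open>b(t) = \<Sum> R\<^sub>m t\<^sup>m\<close>
  over even \<open>m > 0\<close>. The definition of \<open>R\<close> says \<open>b = (y - 1) y\<close>, and \<open>Q(t) = \<Sum>\<^sub>k q\<^sub>k t\<^sup>k = a + 2 y - 1\<close>. Hence
  \<open>x\<^sup>d\<close> is an eigenvector, with eigenvalue \<open>Q\<close>, of the transfer operator of the counter: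
  \<open>1 + a + 2 b x = Q\<close> and \<open>x\<^bsup>d - 1\<^esup> + a x\<^sup>d + b x\<^bsup>d + 1\<^esup> = Q x\<^sup>d\<close> for \<open>d > 0\<close>. If \<open>T = z Q(T)\<close>, it
  follows that the words that first descend by \<open>h\<close> at their end, read with initial counter
  \<open>d \<le> h\<close>, have generating function \<open>T\<^sup>h x(T)\<^sup>d\<close> on the garage side; for \<open>d = 0\<close> this is \<open>T\<^sup>h\<close>, the
  generating function of the left side.
\<close>

section \<open>Newton's identities and the image of the complete symmetric functions\<close>

lemma coeff_sym_sum: "coeff_sym (\<Sum>x\<in>A. f x) m = (\<Sum>x\<in>A. coeff_sym (f x) m)"
  by (induction A rule: infinite_finite_induct) (simp_all add: zero_sym.rep_eq plus_sym.rep_eq)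

lemma coeff_sym_of_nat_mult: "coeff_sym (of_nat n * f) m = of_nat n * coeff_sym f m"
  by (induction n) (simp_all add: algebra_simps zero_sym.rep_eq plus_sym.rep_eq)

lemma sym_eqI: "(\<And>m. coeff_sym f m = coeff_sym g m) \<Longrightarrow> f = g"
  by (simp add: coeff_sym_inject[symmetric] fun_eq_iff)

text \<open>Coefficients are rational, so \<open>n\<close> can be divided out; this is what lets a
  Newton recurrence determine its sequence.\<close>

lemma of_nat_mult_sym_cancel:
  fixes f g :: sym
  assumes "of_nat n * f = of_nat n * g" "n > 0"
  shows "f = g"
proof (rule sym_eqI)
  fix m
  have "of_nat n * coeff_sym f m = of_nat n * coeff_sym g m"
    using assms(1) by (metis coeff_sym_of_nat_mult)
  then show "coeff_sym f m = coeff_sym g m"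
    using assms(2) by simp
qed

lemma sym_scale_two: "sym_scale 2 f = 2 * f"
proof (rule sym_eqI)
  fix m show "coeff_sym (sym_scale 2 f) m = coeff_sym (2 * f) m"
    using coeff_sym_of_nat_mult[of 2 f m] by (simp add: sym_scale.rep_eq)
qed

lemma coeff_sym_p_mult:
  assumes "i \<ge> 1"
  shows "coeff_sym (sym_p i * f) m =
    (\<Sum>j | j \<in> Poly_Mapping.keys m \<and> i \<le> Poly_Mapping.lookup m j.
       coeff_sym f (m - Poly_Mapping.single j i))"
proof -
  let ?S = "\<lambda>j. Poly_Mapping.single j i"
  let ?J = "{j. j \<in> Poly_Mapping.keys m \<and> i \<le> Poly_Mapping.lookup m j}"
  \<comment> \<open>With \<open>i \<ge> 1\<close> the index \<open>j\<close> can be recovered from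
    the monomial.\<close>
  have inj: "inj_on (\<lambda>j. (?S j, m - ?S j)) ?J"
    using assms by (intro inj_onI) (metis Pair_inject lookup_single_eq lookup_single_not_eq not_one_le_zero)
  have split: "?S j + (m - ?S j) = m" if "i \<le> Poly_Mapping.lookup m j" for j
    using that by (intro poly_mapping_eqI) (auto simp: lookup_add lookup_minus lookup_single when_def)
  have "coeff_sym (sym_p i * f) m =
      (\<Sum>(a, b)\<in>splits m. (if \<exists>j. a = ?S j then 1 else 0) * coeff_sym f b)"
    by (simp add: times_sym.rep_eq sym_p.rep_eq)
  also have "\<dots> = (\<Sum>(a, b)\<in>(\<lambda>j. (?S j, m - ?S j)) ` ?J. (if \<exists>j. a = ?S j then 1 else 0) * coeff_sym f b)"
  proof (rule sum.mono_neutral_right[OF finite_splits])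
    show "(\<lambda>j. (?S j, m - ?S j)) ` ?J \<subseteq> splits m"
      using split by (auto simp: splits_def)
    show "\<forall>z\<in>splits m - (\<lambda>j. (?S j, m - ?S j)) ` ?J.
        (case z of (a, b) \<Rightarrow> (if \<exists>j. a = ?S j then 1 else 0) * coeff_sym f b) = 0"
    proof (clarify, rule ccontr)
      fix a b assume ab: "(a, b) \<in> splits m" "(a, b) \<notin> (\<lambda>j. (?S j, m - ?S j)) ` ?J"
        and "(if \<exists>j. a = ?S j then 1 else 0) * coeff_sym f b \<noteq> 0"
      then obtain j where j: "a = ?S j" by (auto split: if_splits)
      have m: "m = ?S j + b" using ab j by (simp add: splits_def)
      then have "j \<in> ?J" using assms by (simp add: in_keys_iff lookup_add)
      moreover have "b = m - ?S j" using m by simp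
      ultimately show False using ab j by blast
    qed
  qed
  also have "\<dots> = (\<Sum>j\<in>?J. coeff_sym f (m - ?S j))"
    by (subst sum.reindex[OF inj]) (auto intro!: sum.cong)
  finally show ?thesis .
qed

lemma mono_deg_minus_single:
  assumes "i \<le> Poly_Mapping.lookup m j"
  shows "mono_deg (m - Poly_Mapping.single j i) = mono_deg m - i"
proof -
  have "m = (m - Poly_Mapping.single j i) + Poly_Mapping.single j i"
    using assms
    by (intro poly_mapping_eqI) (auto simp: lookup_add lookup_minus lookup_single when_def)
  then show ?thesis
    by (metis mono_deg_plus mono_deg_single add_diff_cancel_right')
qed

text \<open>Common core of both Newton identities: after exchanging the sums, the power removed from
  each variable of \<open>m\<close> ranges up to its exponent. The hypothesis is homogeneity of
  \<open>f (n - i)\<close>, which confines everything to degree \<open>n\<close>.\<close>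

lemma sum_coeff_sym_p_mult:
  assumes "\<And>i m. i \<le> n \<Longrightarrow> mono_deg m \<noteq> n - i \<Longrightarrow> coeff_sym (f (n - i)) m = 0"
  shows "(\<Sum>i=1..n. c i * coeff_sym (sym_p i * f (n - i)) m) =
    (if mono_deg m = n then \<Sum>j\<in>Poly_Mapping.keys m. \<Sum>i=1..Poly_Mapping.lookup m j.
        c i * coeff_sym (f (n - i)) (m - Poly_Mapping.single j i) else 0)"
proof (cases "mono_deg m = n")
  case True
  let ?g = "\<lambda>i j. c i * coeff_sym (f (n - i)) (m - Poly_Mapping.single j i)"
  have "(\<Sum>i=1..n. c i * coeff_sym (sym_p i * f (n - i)) m) =
      (\<Sum>i=1..n. \<Sum>j | j \<in> Poly_Mapping.keys m \<and> i \<le> Poly_Mapping.lookup m j. ?g i j)"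
    by (intro sum.cong refl) (simp add: coeff_sym_p_mult sum_distrib_left)
  also have "\<dots> = (\<Sum>j\<in>Poly_Mapping.keys m. \<Sum>i | i \<in> {1..n} \<and> i \<le> Poly_Mapping.lookup m j. ?g i j)"
    by (rule sum.swap_restrict) auto
  also have "\<dots> = (\<Sum>j\<in>Poly_Mapping.keys m. \<Sum>i=1..Poly_Mapping.lookup m j. ?g i j)"
  proof (intro sum.cong refl)
    fix j show "{i. i \<in> {1..n} \<and> i \<le> Poly_Mapping.lookup m j} = {1..Poly_Mapping.lookup m j}"
      using lookup_le_mono_deg[of m j] True by auto
  qed
  finally show ?thesis using True by simp
next
  case False
  have "coeff_sym (sym_p i * f (n - i)) m = 0" if "i \<in> {1..n}" for i
  proof -
    have "coeff_sym (f (n - i)) (m - Poly_Mapping.single j i) = 0"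
      if "i \<le> Poly_Mapping.lookup m j" for j
      using that False \<open>i \<in> {1..n}\<close> lookup_le_mono_deg[of m j]
      by (intro assms) (auto simp: mono_deg_minus_single)
    then show ?thesis using that by (auto simp: coeff_sym_p_mult intro!: sum.neutral)
  qed
  then show ?thesis using False by simp
qed

lemma newton_h: "of_nat n * sym_h n = (\<Sum>i=1..n. sym_p i * sym_h (n - i))"
proof (rule sym_eqI)
  fix m
  have "coeff_sym (\<Sum>i=1..n. sym_p i * sym_h (n - i)) m =
      (\<Sum>i=1..n. 1 * coeff_sym (sym_p i * sym_h (n - i)) m)"
    by (simp add: coeff_sym_sum)
  also have "\<dots> = (if mono_deg m = n then \<Sum>j\<in>Poly_Mapping.keys m. \<Sum>i=1..Poly_Mapping.lookup m j.
        1 * coeff_sym (sym_h (n - i)) (m - Poly_Mapping.single j i) else 0)"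
    by (rule sum_coeff_sym_p_mult) (simp add: sym_h.rep_eq)
  also have "\<dots> = (if mono_deg m = n then \<Sum>j\<in>Poly_Mapping.keys m. of_nat (Poly_Mapping.lookup m j) else 0)"
    by (auto intro!: sum.cong simp: sym_h.rep_eq mono_deg_minus_single)
  also have "\<dots> = coeff_sym (of_nat n * sym_h n) m"
    by (auto simp: coeff_sym_of_nat_mult sym_h.rep_eq mono_deg_def)
  finally show "coeff_sym (of_nat n * sym_h n) m = coeff_sym (\<Sum>i=1..n. sym_p i * sym_h (n - i)) m" ..
qed

text \<open>Only \<open>i = k - 1\<close> and \<open>i = k\<close> can contribute, and for
  \<open>k \<ge> 2\<close> they cancel.\<close>

lemma alternating_sum_last_two:
  fixes k :: nat
  shows "(\<Sum>i=1..k. (if even i then -1 else 1 :: rat) * (if k - i \<le> 1 then 1 else 0)) =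
    (if k = 1 then 1 else 0)"
proof -
  consider "k = 0" | "k = 1" | l where "k = Suc (Suc l)"
    by (metis One_nat_def not0_implies_Suc)
  then show ?thesis
  proof cases
    case (3 l)
    have "(\<Sum>i=1..l. (if even i then -1 else 1 :: rat) * (if k - i \<le> 1 then 1 else 0)) = 0"
      using 3 by (intro sum.neutral) auto
    then show ?thesis using 3 by simp
  qed auto
qed

lemma newton_e:
  "of_nat n * sym_e n = (\<Sum>i=1..n. (if even i then - sym_p i else sym_p i) * sym_e (n - i))"
proof (rule sym_eqI)
  fix m :: mono
  let ?l = "Poly_Mapping.lookup m"
  let ?c = "\<lambda>i::nat. if even i then -1 else 1 :: rat"
  let ?sf = "\<forall>i. ?l i \<le> 1"
  \<comment> \<open>Removing the \<open>i\<close>-th power of variable \<open>j\<close> leaves a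
    squarefree monomial iff the other exponents are at most 1 and at most 1 remains at
    \<open>j\<close>; the alternating sum then singles out exponent exactly 1.\<close>
  have inner: "(\<Sum>i=1..?l j. ?c i * coeff_sym (sym_e (n - i)) (m - Poly_Mapping.single j i)) =
      (if ?sf then 1 else 0)" if "mono_deg m = n" "j \<in> Poly_Mapping.keys m" for j
  proof -
    have "coeff_sym (sym_e (n - i)) (m - Poly_Mapping.single j i) =
        (if \<forall>j'. j' \<noteq> j \<longrightarrow> ?l j' \<le> 1 then 1 else 0) * (if ?l j - i \<le> 1 then 1 else 0)"
      if "i \<le> ?l j" for i
    proof -
      have "(\<forall>j'. Poly_Mapping.lookup (m - Poly_Mapping.single j i) j' \<le> 1) \<longleftrightarrow>
          (\<forall>j'. j' \<noteq> j \<longrightarrow> ?l j' \<le> 1) \<and> ?l j - i \<le> 1"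
        by (auto simp: lookup_minus lookup_single when_def split: if_splits)
      then show ?thesis
        using \<open>mono_deg m = n\<close> mono_deg_minus_single[OF that] by (auto simp: sym_e.rep_eq)
    qed
    then have "(\<Sum>i=1..?l j. ?c i * coeff_sym (sym_e (n - i)) (m - Poly_Mapping.single j i)) =
       (\<Sum>i=1..?l j. (if \<forall>j'. j' \<noteq> j \<longrightarrow> ?l j' \<le> 1 then 1 else 0) *
          (?c i * (if ?l j - i \<le> 1 then 1 else 0)))"
      by (intro sum.cong refl) simp
    also have "\<dots> = (if \<forall>j'. j' \<noteq> j \<longrightarrow> ?l j' \<le> 1 then 1 else 0) * (if ?l j = 1 then 1 else 0)"
      unfolding sum_distrib_left[symmetric] alternating_sum_last_two ..
    also have "\<dots> = (if ?sf then 1 else 0)"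
      using that(2) by (auto simp: in_keys_iff le_Suc_eq)
    finally show ?thesis .
  qed
  have neg: "coeff_sym ((if even i then - sym_p i else sym_p i) * f) m = ?c i * coeff_sym (sym_p i * f) m"
    for i f
    by (simp add: uminus_sym.rep_eq)
  have "coeff_sym (\<Sum>i=1..n. (if even i then - sym_p i else sym_p i) * sym_e (n - i)) m =
      (\<Sum>i=1..n. ?c i * coeff_sym (sym_p i * sym_e (n - i)) m)"
    unfolding coeff_sym_sum neg ..
  also have "\<dots> = (if mono_deg m = n then \<Sum>j\<in>Poly_Mapping.keys m. \<Sum>i=1..?l j.
        ?c i * coeff_sym (sym_e (n - i)) (m - Poly_Mapping.single j i) else 0)"
    by (rule sum_coeff_sym_p_mult) (simp add: sym_e.rep_eq)
  also have "\<dots> = (if mono_deg m = n then \<Sum>j\<in>Poly_Mapping.keys m. if ?sf then 1 else 0 else 0)"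
    using inner by (auto intro!: sum.cong)
  also have "\<dots> = coeff_sym (of_nat n * sym_e n) m"
  proof -
    have "mono_deg m = card (Poly_Mapping.keys m)" if ?sf
    proof -
      have "?l j = 1" if "j \<in> Poly_Mapping.keys m" for j
        using that \<open>?sf\<close> by (metis in_keys_iff le_neq_implies_less less_one)
      then show ?thesis by (simp add: mono_deg_def)
    qed
    then show ?thesis by (auto simp: coeff_sym_of_nat_mult sym_e.rep_eq)
  qed
  finally show "coeff_sym (of_nat n * sym_e n) m =
    coeff_sym (\<Sum>i=1..n. (if even i then - sym_p i else sym_p i) * sym_e (n - i)) m" ..
qed

text \<open>The one-row Schur Q-function: the coefficient of \<open>t^n\<close> in
  \<open>H(t) E(t)\<close>.\<close>

definition sym_Q :: "nat \<Rightarrow> sym" where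
  "sym_Q n = (\<Sum>i=0..n. sym_h i * sym_e (n - i))"

section \<open>Newton recurrences as differential equations\<close>

lemma fps_nth_X_mult_deriv: "fps_nth (fps_X * fps_deriv f) n = of_nat n * fps_nth f n"
  by (cases n) simp_all

lemma fps_X_mult_deriv_mult:
  fixes f g :: "'a :: comm_ring_1 fps"
  shows "fps_X * fps_deriv (f * g) = (fps_X * fps_deriv f) * g + f * (fps_X * fps_deriv g)"
proof -
  have "x * (f * d + c * g) = x * c * g + f * (x * d)" for x c d :: "'a fps"
    by (simp add: algebra_simps)
  then show ?thesis unfolding fps_deriv_mult .
qed

text \<open>The recurrence becomes \<open>t F' = C F\<close>, a form suited to products, where
  logarithmic derivatives add.\<close>

lemma fps_newton:
  fixes f c :: "nat \<Rightarrow> 'a :: comm_ring_1"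
  assumes "\<And>n. of_nat n * f n = (\<Sum>i=1..n. c i * f (n - i))"
  shows "fps_X * fps_deriv (Abs_fps f) = Abs_fps (\<lambda>i. if i = 0 then 0 else c i) * Abs_fps f"
proof (rule fps_ext)
  fix n
  have "(\<Sum>i=0..n. (if i = 0 then 0 else c i) * f (n - i)) = (\<Sum>i=1..n. c i * f (n - i))"
    by (simp add: sum.atLeast_Suc_atMost)
  then have "fps_nth (Abs_fps (\<lambda>i. if i = 0 then 0 else c i) * Abs_fps f) n = of_nat n * f n"
    using assms[of n] by (simp add: fps_mult_nth)
  then show "fps_nth (fps_X * fps_deriv (Abs_fps f)) n =
      fps_nth (Abs_fps (\<lambda>i. if i = 0 then 0 else c i) * Abs_fps f) n"
    by (simp add: fps_nth_X_mult_deriv)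
qed

text \<open>Adding the logarithmic derivatives of the series of \<open>sym_h\<close> and
  \<open>sym_e\<close> cancels the even power sums and doubles the odd ones.\<close>

lemma newton_Q:
  "of_nat n * sym_Q n = (\<Sum>i=1..n. (if odd i then 2 * sym_p i else 0) * sym_Q (n - i))"
proof -
  let ?H = "Abs_fps sym_h" and ?E = "Abs_fps sym_e"
  let ?a = "Abs_fps (\<lambda>i. if i = 0 then 0 else sym_p i)"
  let ?b = "Abs_fps (\<lambda>i. if i = 0 then 0 else if even i then - sym_p i else sym_p i)"
  let ?c = "Abs_fps (\<lambda>i. if odd i then 2 * sym_p i else 0)"
  have H: "fps_X * fps_deriv ?H = ?a * ?H"
    by (rule fps_newton) (rule newton_h)
  have E: "fps_X * fps_deriv ?E = ?b * ?E"
    by (rule fps_newton) (rule newton_e)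
  have Q: "Abs_fps sym_Q = ?H * ?E"
    by (rule fps_ext) (simp add: sym_Q_def fps_mult_nth)
  have "?a + ?b = ?c"
    by (rule fps_ext) (simp flip: mult_2)
  have "fps_X * fps_deriv (Abs_fps sym_Q) = (fps_X * fps_deriv ?H) * ?E + ?H * (fps_X * fps_deriv ?E)"
    unfolding Q by (rule fps_X_mult_deriv_mult)
  also have "\<dots> = (?a + ?b) * (?H * ?E)"
    unfolding H E by (simp only: algebra_simps)
  also have "\<dots> = ?c * Abs_fps sym_Q"
    by (simp only: \<open>?a + ?b = ?c\<close> Q)
  finally have "fps_nth (fps_X * fps_deriv (Abs_fps sym_Q)) n = fps_nth (?c * Abs_fps sym_Q) n"
    by simp
  then show ?thesis
    unfolding fps_nth_X_mult_deriv by (simp add: fps_mult_nth sum.atLeast_Suc_atMost)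
qed

lemma mono_deg_eq_0_iff: "mono_deg m = 0 \<longleftrightarrow> m = 0"
  by (metis le_zero_eq lookup_le_mono_deg lookup_zero mono_deg_zero poly_mapping_eqI)

lemma sym_h_0: "sym_h 0 = 1"
  by (rule sym_eqI) (simp add: sym_h.rep_eq one_sym.rep_eq mono_deg_eq_0_iff)

lemma sym_e_0: "sym_e 0 = 1"
  by (rule sym_eqI) (auto simp: sym_e.rep_eq one_sym.rep_eq mono_deg_eq_0_iff)

lemma sym_Q_0 [simp]: "sym_Q 0 = 1"
  by (simp add: sym_Q_def sym_h_0 sym_e_0)

lemma sym_Q_eq: "k > 0 \<Longrightarrow> sym_Q k = 2 * sym_P k"
proof -
  assume "k > 0"
  then have "sym_P k = sym_scale (1/2) (sym_Q k)"
    by (simp add: sym_P_def sym_Q_def)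
  moreover have "sym_scale 2 (sym_scale (1/2) (sym_Q k)) = sym_Q k"
    by (rule sym_eqI) (simp add: sym_scale.rep_eq)
  ultimately show ?thesis by (simp add: sym_scale_two)
qed

lemma sym_P_0 [simp]: "sym_P 0 = 1"
  by (simp add: sym_P_def)

section \<open>The action of \<open>sh\<close> on complete symmetric functions\<close>

context
  fixes sh :: "sym \<Rightarrow> sym"
  assumes sh: "is_sh sh"
begin

lemma sh_add: "sh (f + g) = sh f + sh g"
  using sh by (simp add: is_sh_def sym_alg_endo_def linear_iff_module_hom module_hom_iff)

lemma sh_mult: "sh (f * g) = sh f * sh g" and sh_one: "sh 1 = 1"
  using sh by (simp_all add: is_sh_def sym_alg_endo_def)

lemma sh_zero: "sh 0 = 0"
  using sh_add[of 0 0] by simp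

lemma sh_sum: "sh (\<Sum>x\<in>A. f x) = (\<Sum>x\<in>A. sh (f x))"
  by (induction A rule: infinite_finite_induct) (simp_all add: sh_zero sh_add)

lemma sh_of_nat: "sh (of_nat n) = of_nat n"
  by (induction n) (simp_all add: sh_zero sh_add sh_one)

lemma sh_prod_mset: "sh (\<Prod>k\<in>#M. f k) = (\<Prod>k\<in>#M. sh (f k))"
  by (induction M) (simp_all add: sh_one sh_mult)

lemma sh_sym_p:
  assumes "i \<ge> 1"
  shows "sh (sym_p i) = (if odd i then 2 * sym_p i else 0)"
proof (cases "even i")
  case True
  then obtain k where "i = 2 * k" by blast
  then show ?thesis using assms sh by (simp add: is_sh_def)
next
  case False
  then obtain k where "i = 2 * k + 1" using oddE by blast
  then have "i = 2 * (k + 1) - 1" by simp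
  then show ?thesis using False sh by (auto simp: is_sh_def sym_scale_two)
qed

text \<open>\<open>sh\<close> turns the recurrence \<open>newton_h\<close> into
  \<open>newton_Q\<close>, and both sequences start at 1.\<close>

lemma sh_sym_h: "sh (sym_h n) = sym_Q n"
proof (induction n rule: less_induct)
  case (less n)
  show ?case
  proof (cases "n = 0")
    case True
    then show ?thesis by (simp add: sym_h_0 sh_one)
  next
    case False
    have "of_nat n * sh (sym_h n) = sh (of_nat n * sym_h n)"
      by (simp add: sh_mult sh_of_nat)
    also have "\<dots> = (\<Sum>i=1..n. (if odd i then 2 * sym_p i else 0) * sym_Q (n - i))"
      unfolding newton_h sh_sum sh_mult
      by (intro sum.cong refl arg_cong2[where f = times] sh_sym_p less.IH) auto
    also have "\<dots> = of_nat n * sym_Q n"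
      by (rule newton_Q[symmetric])
    finally show ?thesis
      using False by (blast intro: of_nat_mult_sym_cancel)
  qed
qed

end

section \<open>Lukasiewicz words and the kernel equation\<close>

text \<open>
  The letter \<open>a\<close> is a step of height \<open>a - 1\<close>, and a word in \<open>Luk N h\<close> is a path of length \<open>N\<close> that
  reaches the level \<open>-h\<close> for the first time at its end.
\<close>

definition Luk :: "nat \<Rightarrow> nat \<Rightarrow> nat list set" where
  "Luk N h = {w. length w = N \<and> sum_list w + h = N \<and> (\<forall>i<N. i < sum_list (take i w) + h)}"

lemma Luk_0: "Luk 0 h = (if h = 0 then {[]} else {})"
  by (auto simp: Luk_def)

lemma Luk_Suc_0: "Luk (Suc N) 0 = {}"
  by (auto simp: Luk_def)

lemma Luk_empty: "N < h \<Longrightarrow> Luk N h = {}"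
  by (auto simp: Luk_def)

text \<open>A first step of height \<open>a - 1\<close> changes the remaining descent from
  \<open>h + 1\<close> to \<open>h + a\<close>.\<close>

lemma Cons_in_Luk: "a # w \<in> Luk (Suc N) (Suc h) \<longleftrightarrow> w \<in> Luk N (h + a)"
  by (auto simp: Luk_def All_less_Suc2 algebra_simps)

lemma finite_Luk: "finite (Luk N h)"
proof (rule finite_subset)
  show "Luk N h \<subseteq> {w. set w \<subseteq> {..N} \<and> length w = N}"
    using member_le_sum_list by (fastforce simp: Luk_def)
  show "finite {w. set w \<subseteq> {..N} \<and> length w = N}"
    by (rule finite_lists_length_eq) simp
qed

lemma sum_Luk_Suc:
  fixes F :: "nat list \<Rightarrow> 'a :: comm_monoid_add"
  shows "(\<Sum>w\<in>Luk (Suc N) (Suc h). F w) = (\<Sum>a\<le>N. \<Sum>w\<in>Luk N (h + a). F (a # w))"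
proof -
  have "(\<Sum>a\<le>N. \<Sum>w\<in>Luk N (h + a). F (a # w)) =
      (\<Sum>(a, w)\<in>(SIGMA a:{..N}. Luk N (h + a)). F (a # w))"
    by (rule sum.Sigma) (auto simp: finite_Luk)
  also have "\<dots> = (\<Sum>w\<in>Luk (Suc N) (Suc h). F w)"
  proof (rule sum.reindex_bij_witness[where j = "\<lambda>(a, w). a # w" and i = "\<lambda>w. (hd w, tl w)"])
    fix w assume w: "w \<in> Luk (Suc N) (Suc h)"
    then have "w = hd w # tl w"
      by (cases w) (auto simp: Luk_def)
    moreover from this have "tl w \<in> Luk N (h + hd w)"
      using w Cons_in_Luk by metis
    \<comment> \<open>A larger first letter would require a descent longer than the \<open>N\<close>
      remaining steps.\<close>
    moreover from this have "hd w \<le> N"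
      using Luk_empty[of N "h + hd w"] by (cases "hd w \<le> N") auto
    ultimately show "(hd w, tl w) \<in> (SIGMA a:{..N}. Luk N (h + a))"
      "(case (hd w, tl w) of (a, w) \<Rightarrow> a # w) = w" by auto
  qed (auto simp: Cons_in_Luk)
  finally show ?thesis ..
qed

definition LukQ :: "nat \<Rightarrow> nat \<Rightarrow> sym" where
  "LukQ N h = (\<Sum>w\<in>Luk N h. \<Prod>a\<leftarrow>w. sym_Q a)"

lemma LukQ_Suc: "LukQ (Suc N) (Suc h) = (\<Sum>a\<le>N. sym_Q a * LukQ N (h + a))"
  by (simp add: LukQ_def sum_Luk_Suc sum_distrib_left)

lemma LukQ_0: "LukQ N h = 0" if "N < h"
  using that by (simp add: LukQ_def Luk_empty)

text \<open>
  \<open>umbral N g\<close> is the coefficient of \<open>z\<^sup>N\<close> in \<open>g(T)\<close>, where \<open>T = z Q(T)\<close>: by decomposition at first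
  passages \<open>LukQ N h\<close> is the coefficient of \<open>z\<^sup>N\<close> in \<open>T\<^sup>h\<close>.
\<close>

definition umbral :: "nat \<Rightarrow> sym fps \<Rightarrow> sym" where
  "umbral N g = (\<Sum>j\<le>N. fps_nth g j * LukQ N j)"

lemma umbral_add: "umbral N (f + g) = umbral N f + umbral N g"
  by (simp add: umbral_def algebra_simps sum.distrib)

lemma umbral_mult: "umbral N (f * g) = (\<Sum>i\<le>N. fps_nth f i * umbral N (fps_X ^ i * g))"
proof -
  have "umbral N (f * g) = (\<Sum>j\<le>N. \<Sum>i\<le>j. fps_nth f i * fps_nth g (j - i) * LukQ N j)"
    by (simp add: umbral_def fps_mult_nth sum_distrib_right atLeast0AtMost)
  also have "\<dots> = (\<Sum>j\<le>N. \<Sum>i\<le>N. if j < i then 0 else fps_nth f i * fps_nth g (j - i) * LukQ N j)"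
    by (intro sum.cong refl sum.mono_neutral_cong_left) auto
  also have "\<dots> = (\<Sum>i\<le>N. \<Sum>j\<le>N. if j < i then 0 else fps_nth f i * fps_nth g (j - i) * LukQ N j)"
    by (rule sum.swap)
  also have "\<dots> = (\<Sum>i\<le>N. fps_nth f i * umbral N (fps_X ^ i * g))"
    unfolding umbral_def sum_distrib_left fps_X_power_mult_nth
    by (intro sum.cong refl) auto
  finally show ?thesis .
qed

lemma umbral_X_power: "umbral N (fps_X ^ h) = LukQ N h"
proof -
  have "umbral N (fps_X ^ h) = (\<Sum>j\<le>N. if h = j then LukQ N j else 0)"
    unfolding umbral_def by (intro sum.cong) auto
  then show ?thesis by (simp add: LukQ_0)
qed

text \<open>This is \<open>T g(T) = z Q(T) g(T)\<close> read at \<open>z^(N+1)\<close>; on powers of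
  \<open>T\<close> it is the first-letter recursion.\<close>

lemma umbral_X_mult: "umbral (Suc N) (fps_X * g) = umbral N (Abs_fps sym_Q * g)"
proof -
  have step: "LukQ (Suc N) (Suc h) = umbral N (Abs_fps sym_Q * fps_X ^ h)" for h
    by (simp add: umbral_mult LukQ_Suc umbral_X_power add.commute flip: power_add)
  have "umbral (Suc N) (fps_X * g) = (\<Sum>j\<le>N. fps_nth g j * LukQ (Suc N) (Suc j))"
    by (simp add: umbral_def sum.atMost_Suc_shift del: sum.atMost_Suc)
  also have "\<dots> = umbral N (g * Abs_fps sym_Q)"
    unfolding step umbral_mult[of N g] by (simp only: mult.commute)
  finally show ?thesis by (simp only: mult.commute)
qed

text \<open>The index \<open>d\<close> is the number of open even letters; a \<open>0\<close> read at \<open>d = 0\<close> closes nothing.\<close>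

fun garage_wt :: "nat \<Rightarrow> nat list \<Rightarrow> sym" where
  "garage_wt d [] = 1"
| "garage_wt d (a # w) =
    (if a = 0 then garage_wt (d - 1) w
     else if odd a then 2 * sym_R a * garage_wt d w
     else (if d = 0 then 2 else 1) * sym_R a * garage_wt (Suc d) w)"

section \<open>Generating functions and the eigenvector equations\<close>

definition fps_y :: "sym fps" where
  "fps_y = Abs_fps (\<lambda>k. if even k then sym_P k else 0)"

definition fps_a :: "sym fps" where
  "fps_a = Abs_fps (\<lambda>k. if odd k then 2 * sym_R k else 0)"

definition fps_b :: "sym fps" where
  "fps_b = Abs_fps (\<lambda>k. if even k \<and> k > 0 then sym_R k else 0)"

text \<open>Over a coefficient ring the reciprocal is built from a given inverse of the constant
  term, here 1.\<close>

definition fps_x :: "sym fps" where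
  "fps_x = fps_right_inverse fps_y 1"

lemma fps_x_y: "fps_y * fps_x = 1"
  unfolding fps_x_def by (rule fps_right_inverse) (simp add: fps_y_def)

lemma fps_nth_two_mult: "fps_nth (2 * f) n = 2 * fps_nth f n"
  by (simp only: mult_2 fps_add_nth)

text \<open>For positive index \<open>sym_Q\<close> is twice \<open>sym_P\<close>, which is
  \<open>sym_R\<close> at odd indices; the \<open>- 1\<close> corrects the constant term.\<close>

lemma fps_Q_eq: "Abs_fps sym_Q = fps_a + (2 * fps_y - 1)"
proof (rule fps_ext)
  fix n
  show "fps_nth (Abs_fps sym_Q) n = fps_nth (fps_a + (2 * fps_y - 1)) n"
    by (cases "n = 0") (auto simp: fps_a_def fps_y_def sym_Q_eq sym_R_def fps_nth_two_mult)
qed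

text \<open>The factor \<open>fps_y - 1\<close> drops index 0, leaving exactly the convolution that
  defines \<open>sym_R\<close> at even indices.\<close>

lemma fps_b_eq: "fps_b = (fps_y - 1) * fps_y"
proof (rule fps_ext)
  fix n
  have "fps_nth ((fps_y - 1) * fps_y) n =
      (\<Sum>i=0..n. if even i \<and> i > 0 \<and> even (n - i) then sym_P i * sym_P (n - i) else 0)"
    unfolding fps_mult_nth by (intro sum.cong refl) (auto simp: fps_y_def)
  also have "\<dots> = (if even n \<and> n > 0 then sym_R n else 0)"
  proof (cases "even n")
    case True
    have "(\<Sum>i=0..n. if even i \<and> i > 0 \<and> even (n - i) then sym_P i * sym_P (n - i) else 0) =
        (\<Sum>i\<in>(*) 2 ` {1..n div 2}. sym_P i * sym_P (n - i))"
      using True by (intro sum.mono_neutral_cong_right) (auto elim!: evenE)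
    also have "\<dots> = (\<Sum>i=1..n div 2. sym_P (2 * i) * sym_P (n - 2 * i))"
      by (subst sum.reindex) (auto intro: inj_onI)
    finally show ?thesis using True by (auto simp: sym_R_def)
  next
    case False
    then show ?thesis by (auto intro!: sum.neutral)
  qed
  finally show "fps_nth fps_b n = fps_nth ((fps_y - 1) * fps_y) n"
    by (simp add: fps_b_def)
qed

lemma kernel_0: "1 + fps_a + 2 * fps_b * fps_x = Abs_fps sym_Q"
proof -
  have "fps_b * fps_x = (fps_y - 1) * (fps_y * fps_x)"
    by (simp only: fps_b_eq mult.assoc)
  then have "fps_b * fps_x = fps_y - 1"
    by (simp add: fps_x_y)
  then have "1 + fps_a + 2 * fps_b * fps_x = 1 + fps_a + 2 * (fps_y - 1)"
    by (simp only: mult.assoc)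
  then show ?thesis
    by (simp add: fps_Q_eq algebra_simps)
qed

text \<open>By \<open>fps_x_y\<close> each term is a multiple of \<open>fps_x ^ Suc d\<close>, with
  factors \<open>y\<close>, \<open>a\<close> and \<open>y - 1\<close> adding up to
  \<open>Q\<close>.\<close>

lemma kernel_Suc:
  "fps_x ^ d + fps_a * fps_x ^ Suc d + fps_b * fps_x ^ Suc (Suc d) = Abs_fps sym_Q * fps_x ^ Suc d"
proof -
  have "fps_b * fps_x ^ Suc (Suc d) = (fps_y - 1) * (fps_y * fps_x) * fps_x ^ Suc d"
    by (simp only: fps_b_eq mult.assoc power_Suc)
  also have "\<dots> = (fps_y - 1) * fps_x ^ Suc d"
    by (simp only: fps_x_y mult_1_right)
  finally have b: "fps_b * fps_x ^ Suc (Suc d) = (fps_y - 1) * fps_x ^ Suc d" .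
  have "fps_x ^ d = fps_y * fps_x * fps_x ^ d"
    by (simp only: fps_x_y mult_1)
  then have x: "fps_x ^ d = fps_y * fps_x ^ Suc d"
    by (simp only: mult.assoc power_Suc)
  have "y * z + a * z + (y - 1) * z = (a + (2 * y - 1)) * z" for a y z :: "sym fps"
    by (simp add: algebra_simps)
  then show ?thesis
    unfolding b fps_Q_eq by (subst x) 
qed

text \<open>
  The bound \<open>d \<le> h\<close> is preserved by every step (an even letter raises the path by at least one)
  and forces \<open>d = 0\<close> at the end, where the two sides have to be compared.
\<close>

lemma garage_wt_eq_umbral:
  "d \<le> h \<Longrightarrow> (\<Sum>w\<in>Luk N h. garage_wt d w) = umbral N (fps_X ^ h * fps_x ^ d)"
proof (induction N arbitrary: h d)
  case 0
  \<comment> \<open>For \<open>h = 0\<close> the bound gives \<open>d = 0\<close>; for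
    \<open>h > 0\<close> both sides vanish.\<close>
  then show ?case
    by (cases h) (simp_all add: Luk_0 umbral_def LukQ_def fps_X_power_mult_nth)
next
  case (Suc N)
  show ?case
  proof (cases h)
    case 0
    then show ?thesis
      using Suc.prems umbral_X_power[of "Suc N" 0] by (simp add: Luk_Suc_0 LukQ_def)
  next
    case (Suc k)
    let ?U = "\<lambda>a e. umbral N (fps_X ^ a * (fps_X ^ k * fps_x ^ e))"
    let ?c = "if d = 0 then 2 else 1 :: sym"
    let ?c' = "if d = 0 then 2 else 1 :: sym fps"
    have IH: "(\<Sum>w\<in>Luk N (k + a). garage_wt e w) = ?U a e" if "e \<le> k + a" for a e
      using Suc.IH[OF that] by (simp add: power_add mult_ac)
    have "(\<Sum>w\<in>Luk (Suc N) h. garage_wt d w) = (\<Sum>a\<le>N. \<Sum>w\<in>Luk N (k + a). garage_wt d (a # w))"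
      unfolding Suc by (rule sum_Luk_Suc)
    \<comment> \<open>The three coefficients are supported on \<open>a = 0\<close>, odd
      \<open>a\<close> and even \<open>a > 0\<close>, so each letter meets only its own
      term.\<close>
    also have "\<dots> = (\<Sum>a\<le>N. fps_nth 1 a * ?U a (d - 1) + fps_nth fps_a a * ?U a d +
        fps_nth (?c' * fps_b) a * ?U a (Suc d))"
    proof (intro sum.cong refl)
      fix a :: nat
      consider "a = 0" | "odd a" | "even a" "a > 0" by (cases "a = 0") auto
      then show "(\<Sum>w\<in>Luk N (k + a). garage_wt d (a # w)) =
        fps_nth 1 a * ?U a (d - 1) + fps_nth fps_a a * ?U a d + fps_nth (?c' * fps_b) a * ?U a (Suc d)"
      proof cases
        case 1
        then show ?thesis
          using IH[of "d - 1" 0] Suc.prems Suc by (simp add: fps_a_def fps_b_def)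
      next
        case 2
        then have "a > 0" by (auto intro: Nat.gr0I)
        then show ?thesis
          using 2 IH[of d a] Suc.prems Suc by (simp add: fps_a_def fps_b_def fps_nth_two_mult flip: sum_distrib_left)
      next
        case 3
        \<comment> \<open>Here \<open>a \<ge> 2\<close>, which pays for the newly opened
          letter.\<close>
        then have "Suc d \<le> k + a" using Suc.prems Suc by presburger
        moreover have "fps_nth (?c' * fps_b) a = ?c * sym_R a"
          using 3 by (simp add: fps_b_def fps_nth_two_mult)
        ultimately show ?thesis
          using 3 IH[of "Suc d" a] by (simp add: fps_a_def mult.assoc flip: sum_distrib_left)
      qed
    qed
    also have "\<dots> = umbral N (1 * (fps_X ^ k * fps_x ^ (d - 1))) + umbral N (fps_a * (fps_X ^ k * fps_x ^ d)) +
        umbral N (?c' * fps_b * (fps_X ^ k * fps_x ^ Suc d))"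
      by (simp only: sum.distrib umbral_mult[of N 1] umbral_mult[of N fps_a] umbral_mult[of N "?c' * fps_b"])
    also have "\<dots> = umbral N (fps_X ^ k * (fps_x ^ (d - 1) + fps_a * fps_x ^ d + ?c' * fps_b * fps_x ^ Suc d))"
      unfolding umbral_add[symmetric]
      by (simp only: distrib_left mult_1 mult.left_commute[of "fps_X ^ k"])
    \<comment> \<open>At \<open>d = 0\<close> truncated subtraction makes the first term 1, as
      \<open>kernel_0\<close> requires.\<close>
    also have "fps_x ^ (d - 1) + fps_a * fps_x ^ d + ?c' * fps_b * fps_x ^ Suc d = Abs_fps sym_Q * fps_x ^ d"
      using kernel_0 kernel_Suc[of "d - 1"] by (cases d) simp_all
    also have "umbral N (fps_X ^ k * (Abs_fps sym_Q * fps_x ^ d)) = umbral (Suc N) (fps_X ^ h * fps_x ^ d)"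
      unfolding Suc power_Suc mult.assoc umbral_X_mult by (simp only: mult.left_commute)
    finally show ?thesis .
  qed
qed

lemma garage_wt_eq_LukQ: "(\<Sum>w\<in>Luk N h. garage_wt 0 w) = LukQ N h"
  using garage_wt_eq_umbral[of 0 h N] by (simp add: umbral_X_power)

section \<open>Counting signs\<close>

definition ups :: "nat \<Rightarrow> nat" where
  "ups a = (if a = 0 then 0 else if odd a then 1 else 2)"

text \<open>A counter started at \<open>c\<close>, raised by each 2 and lowered by each 0, never
  becomes negative; \<open>c = 0\<close> is the garage condition.\<close>

definition nested :: "nat \<Rightarrow> nat list \<Rightarrow> bool" where
  "nested c u \<longleftrightarrow> (\<forall>v. prefix v u \<longrightarrow> count_list v 0 \<le> count_list v 2 + c)"

lemma nested_Nil: "nested c []"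
  by (simp add: nested_def)

lemma nested_Cons:
  "nested c (x # u) \<longleftrightarrow> (if x = 0 then c > 0 \<and> nested (c - 1) u
     else if x = 2 then nested (Suc c) u else nested c u)"
proof -
  have "nested c (x # u) \<longleftrightarrow>
      (\<forall>v. prefix v u \<longrightarrow> count_list (x # v) 0 \<le> count_list (x # v) 2 + c)"
    by (auto simp: nested_def prefix_Cons)
  also have "\<dots> \<longleftrightarrow> (if x = 0 then c > 0 \<and> nested (c - 1) u
     else if x = 2 then nested (Suc c) u else nested c u)"
  proof (cases "x = 0")
    case True
    show ?thesis
    proof (cases c)
      case 0
      then show ?thesis using True by (auto intro!: exI[of _ "[]"])
    next
      case (Suc k)
      then show ?thesis using True by (simp add: nested_def)
    qed
  qed (auto simp: nested_def)
  finally show ?thesis .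
qed

lemma nested_mono: "nested c u \<Longrightarrow> c \<le> c' \<Longrightarrow> nested c' u"
  by (fastforce simp: nested_def)

text \<open>With \<open>d\<close> open even letters of sign \<open>s\<close> before \<open>w\<close>, the signs that these impose on \<open>w\<close>.\<close>

definition reach :: "nat \<Rightarrow> int \<Rightarrow> nat list \<Rightarrow> int list \<Rightarrow> bool" where
  "reach d s w \<sigma> \<longleftrightarrow> (\<forall>j<length w. d > 0 \<and> ups (w ! j) = 2 \<and> nested (d - 1) (map ups (take j w)) \<longrightarrow> \<sigma> ! j = s)"

lemma reach_0: "reach 0 s w \<sigma>"
  by (simp add: reach_def)

lemma reach_Nil: "reach d s [] \<sigma>"
  by (simp add: reach_def)

lemma reach_antimono: "reach d s w \<sigma> \<Longrightarrow> d' \<le> d \<Longrightarrow> reach d' s w \<sigma>"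
  unfolding reach_def by (meson diff_le_mono nested_mono less_le_trans)

text \<open>The open letters share one sign, so their number suffices as state: a \<open>0\<close>
  closes one, and an even letter met while one is open takes their sign and joins them.\<close>

lemma reach_Cons:
  "reach d s (a # w) (t # \<sigma>) \<longleftrightarrow>
    (if a = 0 then reach (d - 1) s w \<sigma> else if odd a then reach d s w \<sigma>
     else d > 0 \<longrightarrow> t = s \<and> reach (Suc d) s w \<sigma>)"
proof -
  have "reach d s (a # w) (t # \<sigma>) \<longleftrightarrow> (d > 0 \<and> ups a = 2 \<longrightarrow> t = s) \<and>
    (\<forall>j<length w. d > 0 \<and> ups (w ! j) = 2 \<and> nested (d - 1) (ups a # map ups (take j w)) \<longrightarrow> \<sigma> ! j = s)"
    by (simp add: reach_def All_less_Suc2 nested_Nil)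
  then show ?thesis
    by (cases "d = 0") (auto simp: nested_Cons ups_def reach_def)
qed

text \<open>The condition on a pair is charged to its earlier letter, which starts as the single
  open letter, hence \<open>reach 1\<close>.\<close>

fun garage_word :: "nat list \<Rightarrow> int list \<Rightarrow> bool" where
  "garage_word [] [] \<longleftrightarrow> True"
| "garage_word (a # w) (t # \<sigma>) \<longleftrightarrow> t \<in> {-1, 0, 1} \<and> (t = 0 \<longleftrightarrow> a = 0) \<and>
     (ups a = 2 \<longrightarrow> reach 1 t w \<sigma>) \<and> garage_word w \<sigma>"
| "garage_word _ _ \<longleftrightarrow> False"

lemma garage_word_iff:
  "garage_word w \<sigma> \<longleftrightarrow> length \<sigma> = length w \<and>
     (\<forall>i<length w. \<sigma> ! i \<in> {-1, 0, 1} \<and> (\<sigma> ! i = 0 \<longleftrightarrow> w ! i = 0) \<and>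
        (ups (w ! i) = 2 \<longrightarrow> reach 1 (\<sigma> ! i) (drop (Suc i) w) (drop (Suc i) \<sigma>)))"
proof (induction w \<sigma> rule: garage_word.induct)
  case (2 a w t \<sigma>)
  then show ?case by (auto simp: All_less_Suc2)
qed auto

definition signings :: "nat \<Rightarrow> int \<Rightarrow> nat list \<Rightarrow> int list set" where
  "signings d s w = {\<sigma>. garage_word w \<sigma> \<and> reach d s w \<sigma>}"

lemma signings_Nil: "signings d s [] = {[]}"
proof -
  have "garage_word [] \<sigma> \<longleftrightarrow> \<sigma> = []" for \<sigma> by (cases \<sigma>) auto
  then show ?thesis by (auto simp: signings_def reach_Nil)
qed

text \<open>An even letter has a free sign only at \<open>d = 0\<close>. If \<open>d > 0\<close>,
  its own constraint \<open>reach 1\<close> already follows from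
  \<open>reach (Suc d)\<close>.\<close>

lemma signings_Cons:
  assumes "s \<in> {1, -1}"
  shows "signings d s (a # w) =
    (if a = 0 then (#) 0 ` signings (d - 1) s w
     else if odd a then (#) 1 ` signings d s w \<union> (#) (-1) ` signings d s w
     else if d = 0 then (#) 1 ` signings 1 1 w \<union> (#) (-1) ` signings 1 (-1) w
     else (#) s ` signings (Suc d) s w)"
proof -
  have "\<sigma> \<in> signings d s (a # w) \<longleftrightarrow> (\<exists>t \<tau>. \<sigma> = t # \<tau> \<and> garage_word (a # w) (t # \<tau>) \<and> reach d s (a # w) (t # \<tau>))"
    for \<sigma> by (cases \<sigma>) (auto simp: signings_def)
  then have *: "signings d s (a # w) = {t # \<tau> | t \<tau>. garage_word (a # w) (t # \<tau>) \<and> reach d s (a # w) (t # \<tau>)}"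
    by blast
  consider "a = 0" | "odd a" | "even a" "a > 0" "d = 0" | "even a" "a > 0" "d > 0"
    by (cases "a = 0"; cases "d = 0") auto
  then show ?thesis
  proof cases
    case 1
    then have iff: "garage_word (a # w) (t # \<tau>) \<and> reach d s (a # w) (t # \<tau>) \<longleftrightarrow>
        t = 0 \<and> \<tau> \<in> signings (d - 1) s w" for t \<tau>
      by (auto simp: ups_def reach_Cons signings_def)
    show ?thesis unfolding * iff using 1 by auto
  next
    case 2
    then have iff: "garage_word (a # w) (t # \<tau>) \<and> reach d s (a # w) (t # \<tau>) \<longleftrightarrow>
        (t = 1 \<or> t = -1) \<and> \<tau> \<in> signings d s w" for t \<tau>
      by (auto simp: ups_def reach_Cons signings_def)
    have "a \<noteq> 0" using 2 by (auto intro: Nat.gr0I)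
    then show ?thesis unfolding * iff using 2 by auto
  next
    case 3
    then have iff: "garage_word (a # w) (t # \<tau>) \<and> reach d s (a # w) (t # \<tau>) \<longleftrightarrow>
        t = 1 \<and> \<tau> \<in> signings 1 1 w \<or> t = -1 \<and> \<tau> \<in> signings 1 (-1) w" for t \<tau>
      by (auto simp: ups_def reach_Cons signings_def)
    show ?thesis unfolding * iff using 3 by auto
  next
    case 4
    then have iff: "garage_word (a # w) (t # \<tau>) \<and> reach d s (a # w) (t # \<tau>) \<longleftrightarrow>
        t = s \<and> \<tau> \<in> signings (Suc d) s w" for t \<tau>
      using assms reach_antimono[of "Suc d" s w \<tau> 1] by (auto simp: ups_def reach_Cons signings_def)
    show ?thesis unfolding * iff using 4 by auto
  qed
qed

text \<open>The count does not depend on \<open>s\<close>, so the counter \<open>d\<close> alone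
  determines the weight.\<close>

lemma card_signings:
  assumes "s \<in> {1, -1}"
  shows "finite (signings d s w) \<and>
    of_nat (card (signings d s w)) * (\<Prod>a\<leftarrow>w. if a = 0 then 1 else sym_R a) = garage_wt d w"
  using assms
proof (induction w arbitrary: d s)
  case Nil
  then show ?case by (simp add: signings_Nil)
next
  case (Cons a w)
  note fin = Cons.IH[THEN conjunct1] and IH = Cons.IH[THEN conjunct2, symmetric]
  have inj: "card ((#) t ` A) = card A" for t :: int and A
    by (simp add: card_image)
  have un: "card ((#) 1 ` A \<union> (#) (-1) ` B) = card A + card B"
    if "finite A" "finite B" for A B :: "int list set"
    using that by (subst card_Un_disjoint) (auto simp: inj)
  consider "a = 0" | "odd a" | "even a" "a > 0" "d = 0" | "even a" "a > 0" "d > 0"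
    by (cases "a = 0"; cases "d = 0") auto
  then show ?case
  proof cases
    case 1
    then show ?thesis
      using Cons.prems by (simp add: signings_Cons inj fin IH)
  next
    case 2
    then have "a \<noteq> 0" by (auto intro: Nat.gr0I)
    then show ?thesis
      using 2 Cons.prems by (simp add: signings_Cons un fin IH[of s d] algebra_simps)
  next
    case 3
    \<comment> \<open>Both signs of the newly opened letter give the same weight.\<close>
    have "of_nat (card (signings 1 (-1) w) + card (signings 1 1 w)) *
        (\<Prod>a\<leftarrow>w. if a = 0 then 1 else sym_R a) = 2 * garage_wt 1 w"
      unfolding of_nat_add distrib_right using IH[of 1 1] IH[of "-1" 1] by simp
    from arg_cong[OF this, of "(*) (sym_R a)"] show ?thesis
      using 3 Cons.prems by (simp add: signings_Cons un fin algebra_simps)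
  next
    case 4
    then show ?thesis
      using Cons.prems by (simp add: signings_Cons inj fin IH[of s "Suc d"] algebra_simps)
  qed
qed

section \<open>Sorted parking functions as words\<close>

lemma alpha_eq_count_list: "alpha p k = count_list p k"
proof -
  have "alpha p k = card {i. i < length p \<and> k = p ! i}"
    unfolding alpha_def
    by (rule bij_betw_same_card[of "\<lambda>j. j - 1"], rule bij_betw_byWitness[where f' = Suc]) auto
  then show ?thesis
    by (simp add: count_list_eq_length_filter length_filter_conv_card)
qed

lemma sum_count_list_atLeastAtMost:
  fixes p :: "nat list"
  shows "(\<Sum>k=1..i. count_list p k) = length (filter (\<lambda>x. 1 \<le> x \<and> x \<le> i) p)"
proof (induction p)
  case (Cons x p)
  have "(\<Sum>k=1..i. count_list (x # p) k) = (\<Sum>k=1..i. count_list p k + (if x = k then 1 else 0))"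
    by (intro sum.cong) auto
  also have "\<dots> = (\<Sum>k=1..i. count_list p k) + (if x \<in> {1..i} then 1 else 0)"
    by (simp add: sum.distrib sum.delta)
  finally show ?case using Cons.IH by auto
qed simp

text \<open>In a sorted list the entries at most \<open>c\<close> form an initial segment.\<close>

lemma sorted_nth_le_iff:
  fixes p :: "'a :: linorder list"
  assumes "sorted p" "i < length p"
  shows "p ! i \<le> c \<longleftrightarrow> Suc i \<le> length (filter (\<lambda>x. x \<le> c) p)"
proof -
  let ?A = "{j. j < length p \<and> p ! j \<le> c}"
  have "Suc i \<le> card ?A" if "p ! i \<le> c"
  proof -
    have "{..i} \<subseteq> ?A"
      using assms that by (auto intro: order_trans[OF sorted_nth_mono])
    from card_mono[OF _ this] show ?thesis by simp
  qed
  moreover have "card ?A \<le> i" if "c < p ! i"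
  proof -
    have "?A \<subseteq> {..<i}"
      using assms that by (auto simp: not_le[symmetric] dest: order_trans[OF sorted_nth_mono[of p i]])
    from card_mono[OF _ this] show ?thesis by simp
  qed
  ultimately show ?thesis
    unfolding length_filter_conv_card by (meson not_less_eq_eq not_le)
qed

text \<open>
  The word includes \<open>alpha p (n + 1) = 0\<close>: this final step takes the parking path, which stays
  nonnegative and ends at \<open>0\<close>, to its first passage to \<open>-1\<close>.
\<close>

definition alpha_word :: "nat \<Rightarrow> nat list \<Rightarrow> nat list" where
  "alpha_word n p = map (alpha p) [1..<n + 2]"

lemma length_alpha_word [simp]: "length (alpha_word n p) = Suc n"
  by (simp add: alpha_word_def)

lemma nth_alpha_word: "i \<le> n \<Longrightarrow> alpha_word n p ! i = alpha p (Suc i)"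
  by (simp add: alpha_word_def nth_append del: upt_Suc)

lemma sum_take_alpha_word:
  assumes "\<forall>x\<in>set p. 1 \<le> x" "i \<le> Suc n"
  shows "sum_list (take i (alpha_word n p)) = length (filter (\<lambda>x. x \<le> i) p)"
proof -
  have "take i (alpha_word n p) = map (alpha p) [1..<Suc i]"
    unfolding alpha_word_def take_map using assms(2) by (simp add: take_upt del: upt_Suc)
  then have "sum_list (take i (alpha_word n p)) = (\<Sum>k=1..i. count_list p k)"
    by (simp add: alpha_eq_count_list sum_list_distinct_conv_sum_set atLeastLessThanSuc_atLeastAtMost
        del: upt_Suc)
  also have "\<dots> = length (filter (\<lambda>x. x \<le> i) p)"
    unfolding sum_count_list_atLeastAtMost using assms(1)
    by (intro arg_cong[where f = length] filter_cong) auto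
  finally show ?thesis .
qed

text \<open>The \<open>i\<close>-th smallest entry is at most \<open>i\<close> iff at least
  \<open>i\<close> entries are, that is, iff the path is nonnegative after \<open>i\<close> steps.
  The bound \<open>Suc n\<close> makes the word count every entry, so that its sum is the length of
  \<open>p\<close>.\<close>

lemma sorted_Pf_iff:
  assumes "sorted p"
  shows "p \<in> Pf n \<longleftrightarrow> (\<forall>x\<in>set p. 1 \<le> x \<and> x \<le> Suc n) \<and> alpha_word n p \<in> Luk (Suc n) 1"
proof -
  have sum: "sum_list (alpha_word n p) = length p" if "\<forall>x\<in>set p. 1 \<le> x \<and> x \<le> Suc n"
    using sum_take_alpha_word[of p "Suc n" n] that by simp
  have "(\<forall>i\<in>{1..n}. sort p ! (i - 1) \<le> i) \<longleftrightarrow> (\<forall>i<Suc n. i < sum_list (take i (alpha_word n p)) + 1)"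
    if "length p = n" "\<forall>x\<in>set p. 1 \<le> x"
  proof -
    have "sort p ! (i - 1) \<le> i \<longleftrightarrow> i < sum_list (take i (alpha_word n p)) + 1" if "i \<in> {1..n}" for i
      using sorted_nth_le_iff[OF assms, of "i - 1" i] sum_take_alpha_word[of p i n]
        \<open>length p = n\<close> \<open>\<forall>x\<in>set p. 1 \<le> x\<close> that assms
      by (auto simp: sorted_sort_id less_Suc_eq_le)
    moreover have "(\<forall>i<Suc n. P i) \<longleftrightarrow> P 0 \<and> (\<forall>i\<in>{1..n}. P i)" for P
      unfolding less_Suc_eq_le by (metis One_nat_def Suc_leI atLeastAtMost_iff le0 not_gr_zero)
    ultimately show ?thesis by simp
  qed
  moreover have "x \<le> Suc n" if "length p = n" "\<forall>i\<in>{1..n}. sort p ! (i - 1) \<le> i" "x \<in> set p" for x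
  proof -
    obtain j where "j < n" "x = p ! j"
      using \<open>x \<in> set p\<close> \<open>length p = n\<close> by (auto simp: in_set_conv_nth)
    then show ?thesis
      using that(2)[rule_format, of "Suc j"] assms by (simp add: sorted_sort_id)
  qed
  ultimately show ?thesis
    using sum by (auto simp: Pf_def Luk_def)
qed

lemma bij_betw_alpha_word: "bij_betw (alpha_word n) {p \<in> Pf n. sorted p} (Luk (Suc n) 1)"
  unfolding bij_betw_def
proof (intro conjI inj_onI equalityI subsetI)
  fix p q
  assume p: "p \<in> {p \<in> Pf n. sorted p}" and q: "q \<in> {p \<in> Pf n. sorted p}"
    and eq: "alpha_word n p = alpha_word n q"
  have "count_list p k = count_list q k" for k
  proof (cases "k \<in> {1..Suc n}")
    case True
    then show ?thesis
      using arg_cong[OF eq, of "\<lambda>w. w ! (k - 1)"]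
      by (cases k) (simp_all add: nth_alpha_word alpha_eq_count_list)
  next
    case False
    then have "k \<notin> set p" "k \<notin> set q"
      using p q sorted_Pf_iff by auto
    then show ?thesis by (simp add: count_list_0_iff)
  qed
  then have "mset p = mset q"
    by (intro multiset_eqI) (simp add: count_mset)
  then show "p = q"
    using p q by (metis (mono_tags, lifting) mem_Collect_eq properties_for_sort sorted_sort_id)
next
  fix w assume "w \<in> alpha_word n ` {p \<in> Pf n. sorted p}"
  then show "w \<in> Luk (Suc n) 1" by (auto simp: sorted_Pf_iff)
next
  fix w assume w: "w \<in> Luk (Suc n) 1"
  \<comment> \<open>The inverse map: letter \<open>k - 1\<close> of \<open>w\<close> prescribes the
    multiplicity of \<open>k\<close>.\<close>
  define M where "M = (\<Sum>k=1..Suc n. replicate_mset (w ! (k - 1)) k)"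
  define p where "p = sorted_list_of_multiset M"
  have "count M k = (\<Sum>j=1..Suc n. if j = k then w ! (k - 1) else 0)" for k
    unfolding M_def count_sum by (intro sum.cong) auto
  then have M: "count M k = (if k \<in> {1..Suc n} then w ! (k - 1) else 0)" for k
    by (simp add: sum.delta del: sum.cl_ivl_Suc)
  have count: "alpha p k = count M k" for k
    by (simp add: p_def alpha_eq_count_list flip: count_mset)
  have "alpha_word n p = w"
    using w by (intro nth_equalityI) (auto simp: Luk_def nth_alpha_word count M less_Suc_eq_le)
  moreover have "\<forall>x\<in>set p. 1 \<le> x \<and> x \<le> Suc n"
  proof
    fix x assume "x \<in> set p"
    then have "count M x \<noteq> 0" by (simp add: p_def)
    then show "1 \<le> x \<and> x \<le> Suc n" by (auto simp: M split: if_splits)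
  qed
  moreover have "sorted p" by (simp add: p_def)
  ultimately show "w \<in> alpha_word n ` {p \<in> Pf n. sorted p}"
    using w by (auto simp: sorted_Pf_iff intro!: image_eqI[of _ _ p])
qed

text \<open>The path is nonnegative after \<open>n\<close> steps, so all \<open>n\<close> entries
  have been counted by then.\<close>

lemma alpha_Suc_length:
  assumes "p \<in> Pf n" "sorted p"
  shows "alpha p (Suc n) = 0"
proof -
  let ?w = "alpha_word n p"
  have w: "?w \<in> Luk (Suc n) 1"
    using assms sorted_Pf_iff by blast
  have "?w = take n ?w @ [alpha p (Suc n)]"
    by (metis lessI length_alpha_word nth_alpha_word order_refl take_Suc_conv_app_nth take_all)
  then have "sum_list ?w = sum_list (take n ?w) + alpha p (Suc n)"
    by (metis add.right_neutral sum_list.Cons sum_list.Nil sum_list_append)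
  moreover have "sum_list ?w = n" "n \<le> sum_list (take n ?w)"
    using w by (auto simp: Luk_def)
  ultimately show ?thesis by linarith
qed

lemma prod_mset_lam:
  fixes f :: "nat \<Rightarrow> 'a :: comm_monoid_mult"
  assumes "p \<in> Pf n" "sorted p"
  shows "(\<Prod>k\<in>#lam p. f k) = (\<Prod>a\<leftarrow>alpha_word n p. if a = 0 then 1 else f a)"
proof -
  have "{k. alpha p k \<noteq> 0} \<subseteq> {1..Suc n}"
    using assms(1) sorted_Pf_iff[OF assms(2)] by (auto simp: alpha_eq_count_list count_list_0_iff)
  then have "(\<Prod>k | alpha p k \<noteq> 0. f (alpha p k)) =
      (\<Prod>k\<in>{1..Suc n}. if alpha p k = 0 then 1 else f (alpha p k))"
    by (intro prod.mono_neutral_cong_left) auto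
  moreover have "(\<Prod>k\<in>#lam p. f k) = (\<Prod>k | alpha p k \<noteq> 0. f (alpha p k))"
    by (simp add: lam_def prod_unfold_prod_mset image_mset.compositionality comp_def)
  moreover have "{1..Suc n} = set [1..<n + 2]"
    by auto
  ultimately show ?thesis
    by (simp only: alpha_word_def prod.distinct_set_conv_list distinct_upt map_map comp_def)
qed

section \<open>Garages as signed words\<close>

lemma reach_drop_iff:
  assumes "length \<sigma> = length w"
  shows "reach 1 s (drop (Suc i) w) (drop (Suc i) \<sigma>) \<longleftrightarrow>
    (\<forall>j. i < j \<and> j < length w \<and> ups (w ! j) = 2 \<and>
       nested 0 (map ups (take (j - Suc i) (drop (Suc i) w))) \<longrightarrow> \<sigma> ! j = s)"
    (is "?L \<longleftrightarrow> ?R")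
proof
  assume L: ?L
  show ?R
  proof (intro allI impI, elim conjE)
    fix j assume j: "i < j" "j < length w" "ups (w ! j) = 2"
      "nested 0 (map ups (take (j - Suc i) (drop (Suc i) w)))"
    then show "\<sigma> ! j = s"
      using L[unfolded reach_def, rule_format, of "j - Suc i"] assms by simp
  qed
next
  assume R: ?R
  show ?L
    unfolding reach_def
  proof (intro allI impI, elim conjE)
    fix j assume "j < length (drop (Suc i) w)" "ups (drop (Suc i) w ! j) = 2"
      "nested (1 - 1) (map ups (take j (drop (Suc i) w)))"
    then show "drop (Suc i) \<sigma> ! j = s"
      using R[rule_format, of "Suc i + j"] assms by simp
  qed
qed

text \<open>The appended sign 0 belongs to the final letter 0, which is not even and positive and so
  takes part in no sign condition on pairs.\<close>

lemma Gar_iff_garage_word: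
  assumes "p \<in> Pf n" "sorted p" "length \<sigma> = n"
  shows "(p, \<sigma>) \<in> Gar n \<longleftrightarrow> garage_word (alpha_word n p) (\<sigma> @ [0])"
proof -
  let ?w = "alpha_word n p" and ?s = "\<sigma> @ [0]"
  have last: "?w ! n = 0" "?s ! n = 0" "ups (?w ! n) \<noteq> 2"
    using assms alpha_Suc_length by (auto simp: nth_alpha_word nth_append ups_def)
  have nth: "?s ! i = \<sigma> ! i" if "i < n" for i
    using that assms by (simp add: nth_append)
  have split: "(\<forall>i<Suc n. P i) \<longleftrightarrow> P n \<and> (\<forall>i<n. P i)" for P
    by (auto simp: less_Suc_eq)
  have shift: "(\<forall>k\<in>{1..n}. P k) \<longleftrightarrow> (\<forall>i<n. P (Suc i))" for P
    by (metis One_nat_def Suc_pred atLeastAtMost_iff less_Suc_eq_le zero_less_Suc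
        less_eq_Suc_le)
  \<comment> \<open>Position \<open>i\<close> of the word carries \<open>alpha p (Suc i)\<close>,
    hence the shifted interval.\<close>
  have word: "map ups (take (j - Suc i) (drop (Suc i) ?w)) = map (upsilon p) [Suc i + 1..<Suc j]"
    if "i < j" "j < n" for i j
    unfolding alpha_word_def drop_map take_map drop_upt
    using that by (simp add: take_upt upsilon_def ups_def del: upt_Suc)
  have ups: "ups (?w ! i) = upsilon p (Suc i)" if "i < n" for i
    using that by (simp add: nth_alpha_word ups_def upsilon_def)
  have "garage_word ?w ?s \<longleftrightarrow>
     (\<forall>i<n. \<sigma> ! i \<in> {-1, 0, 1} \<and> (\<sigma> ! i = 0 \<longleftrightarrow> alpha p (Suc i) = 0) \<and>
        (upsilon p (Suc i) = 2 \<longrightarrow> reach 1 (\<sigma> ! i) (drop (Suc i) ?w) (drop (Suc i) ?s)))"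
    unfolding garage_word_iff using assms(3) last
    by (simp add: split nth ups) (auto simp: nth_alpha_word)
  also have "\<dots> \<longleftrightarrow> (\<forall>i<n. \<sigma> ! i \<in> {-1, 0, 1} \<and> (\<sigma> ! i = 0 \<longleftrightarrow> alpha p (Suc i) = 0) \<and>
        (upsilon p (Suc i) = 2 \<longrightarrow> (\<forall>j<n. i < j \<and> upsilon p (Suc j) = 2 \<and>
          nested 0 (map (upsilon p) [Suc i + 1..<Suc j]) \<longrightarrow> \<sigma> ! j = \<sigma> ! i)))"
  proof -
    have "reach 1 s (drop (Suc i) ?w) (drop (Suc i) ?s) \<longleftrightarrow> (\<forall>j<n. i < j \<and> upsilon p (Suc j) = 2 \<and>
          nested 0 (map (upsilon p) [Suc i + 1..<Suc j]) \<longrightarrow> \<sigma> ! j = s)" for i s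
    proof -
      have "length ?s = length ?w" using assms by simp
      have "(i < j \<and> j < Suc n \<and> ups (?w ! j) = 2 \<and>
            nested 0 (map ups (take (j - Suc i) (drop (Suc i) ?w))) \<longrightarrow> ?s ! j = s) \<longleftrightarrow>
          (j < n \<longrightarrow> i < j \<and> upsilon p (Suc j) = 2 \<and>
            nested 0 (map (upsilon p) [Suc i + 1..<Suc j]) \<longrightarrow> \<sigma> ! j = s)" for j
      proof (cases "i < j \<and> j < n")
        case True
        then show ?thesis using word[of i j] nth[of j] ups[of j] by simp
      next
        case False
        then show ?thesis using last(3) by (auto simp: less_Suc_eq)
      qed
      then show ?thesis
        unfolding reach_drop_iff[OF \<open>length ?s = length ?w\<close>] length_alpha_word by simp
    qed
    then show ?thesis by simp
  qed
  also have "\<dots> \<longleftrightarrow> (p, \<sigma>) \<in> Gar n"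
  proof -
    have "set \<sigma> \<subseteq> {-1, 0, 1} \<longleftrightarrow> (\<forall>i<n. \<sigma> ! i \<in> {-1, 0, 1})"
      unfolding subset_eq all_set_conv_all_nth assms(3) ..
    moreover have "nested 0 (map (upsilon p) [Suc i + 1..<Suc j]) \<longleftrightarrow>
        (\<forall>v. prefix v (map (upsilon p) [Suc i + 1..<Suc j]) \<longrightarrow> count_list v 2 \<ge> count_list v 0)" for i j
      by (simp only: nested_def add_0_right)
    moreover have "(p, \<sigma>) \<in> Gar n \<longleftrightarrow> set \<sigma> \<subseteq> {-1, 0, 1} \<and> (\<forall>i<n. \<sigma> ! i = 0 \<longleftrightarrow> alpha p (Suc i) = 0) \<and>
        (\<forall>i<n. \<forall>j<n. i < j \<and> upsilon p (Suc i) = 2 \<and> upsilon p (Suc j) = 2 \<and>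
          (\<forall>v. prefix v (map (upsilon p) [Suc i + 1..<Suc j]) \<longrightarrow> count_list v 2 \<ge> count_list v 0) \<longrightarrow>
          \<sigma> ! i = \<sigma> ! j)"
      unfolding Gar_def naive_shifted_pf_def mem_Collect_eq case_prod_conv shift
      by (simp only: assms simp_thms conj_assoc Suc_less_eq diff_Suc_1)
    moreover have logic: "(\<forall>i<n. A i \<and> B i \<and> (U i \<longrightarrow> (\<forall>j<n. i < j \<and> U j \<and> N i j \<longrightarrow> \<sigma> ! j = \<sigma> ! i))) \<longleftrightarrow>
        (\<forall>i<n. A i) \<and> (\<forall>i<n. B i) \<and> (\<forall>i<n. \<forall>j<n. i < j \<and> U i \<and> U j \<and> N i j \<longrightarrow> \<sigma> ! i = \<sigma> ! j)"
      for A B U N by auto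
    ultimately show ?thesis unfolding logic by (simp only:)
  qed
  finally show ?thesis ..
qed

lemma bij_betw_Gar_signings:
  assumes "p \<in> Pf n" "sorted p"
  shows "bij_betw (\<lambda>\<sigma>. \<sigma> @ [0]) {\<sigma>. (p, \<sigma>) \<in> Gar n} (signings 0 1 (alpha_word n p))"
proof (rule bij_betw_byWitness[where f' = butlast])
  have len: "length \<sigma> = n" if "(p, \<sigma>) \<in> Gar n" for \<sigma>
    using that by (simp add: Gar_def naive_shifted_pf_def)
  have split: "butlast \<tau> @ [0] = \<tau>" "length (butlast \<tau>) = n"
    if "\<tau> \<in> signings 0 1 (alpha_word n p)" for \<tau>
  proof -
    have "length \<tau> = Suc n" "\<tau> ! n = 0"
      using that assms by (auto simp: signings_def garage_word_iff nth_alpha_word alpha_Suc_length)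
    then show "length (butlast \<tau>) = n" "butlast \<tau> @ [0] = \<tau>"
      using append_butlast_last_id[of \<tau>] last_conv_nth[of \<tau>] by force+
  qed
  show "\<forall>\<tau>\<in>signings 0 1 (alpha_word n p). butlast \<tau> @ [0] = \<tau>"
    using split by blast
  show "(\<lambda>\<sigma>. \<sigma> @ [0]) ` {\<sigma>. (p, \<sigma>) \<in> Gar n} \<subseteq> signings 0 1 (alpha_word n p)"
    using Gar_iff_garage_word[OF assms] len by (auto simp: signings_def reach_0)
  show "butlast ` signings 0 1 (alpha_word n p) \<subseteq> {\<sigma>. (p, \<sigma>) \<in> Gar n}"
  proof clarify
    fix \<tau> assume "\<tau> \<in> signings 0 1 (alpha_word n p)"
    then show "(p, butlast \<tau>) \<in> Gar n"
      using Gar_iff_garage_word[OF assms split(2)] split(1) by (simp add: signings_def)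
  qed
qed simp

theorem theorem3p9:
  fixes n :: nat and sh :: "sym \<Rightarrow> sym"
  assumes "is_sh sh" and "n \<ge> 1"
  shows "sh (PF n) = (\<Sum>(p, \<sigma>)\<in>Gar n. R_part (lam p))"
proof -
  let ?A = "{p \<in> Pf n. sorted p}" and ?L = "Luk (Suc n) 1"
  let ?R = "\<lambda>w. \<Prod>a\<leftarrow>w. if a = 0 then 1 else sym_R a"
  have "sh (PF n) = (\<Sum>p\<in>?A. \<Prod>k\<in>#lam p. sym_Q k)"
    using assms(1) by (simp add: PF_def h_part_def sh_sum sh_prod_mset sh_sym_h)
  also have "\<dots> = (\<Sum>p\<in>?A. \<Prod>a\<leftarrow>alpha_word n p. sym_Q a)"
  proof (rule sum.cong[OF refl])
    fix p assume "p \<in> ?A"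
    \<comment> \<open>Because \<open>sym_Q 0 = 1\<close>, zero letters may stay in the
      product.\<close>
    moreover have "(\<lambda>a. if a = 0 then 1 else sym_Q a) = sym_Q" by auto
    ultimately show "(\<Prod>k\<in>#lam p. sym_Q k) = (\<Prod>a\<leftarrow>alpha_word n p. sym_Q a)"
      using prod_mset_lam[of p n sym_Q] by simp
  qed
  also have "\<dots> = LukQ (Suc n) 1"
    unfolding LukQ_def by (rule sum.reindex_bij_betw[OF bij_betw_alpha_word])
  also have "\<dots> = (\<Sum>w\<in>?L. garage_wt 0 w)"
    by (rule garage_wt_eq_LukQ[symmetric])
  also have "\<dots> = (\<Sum>w\<in>?L. of_nat (card (signings 0 1 w)) * ?R w)"
    using card_signings[of 1 0] by simp
  also have "\<dots> = (\<Sum>p\<in>?A. of_nat (card (signings 0 1 (alpha_word n p))) * ?R (alpha_word n p))"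
    by (rule sum.reindex_bij_betw[OF bij_betw_alpha_word, symmetric])
  also have "\<dots> = (\<Sum>p\<in>?A. \<Sum>\<sigma> | (p, \<sigma>) \<in> Gar n. R_part (lam p))"
  proof (rule sum.cong[OF refl])
    fix p assume "p \<in> ?A"
    then show "of_nat (card (signings 0 1 (alpha_word n p))) * ?R (alpha_word n p) =
        (\<Sum>\<sigma> | (p, \<sigma>) \<in> Gar n. R_part (lam p))"
      using bij_betw_same_card[OF bij_betw_Gar_signings, of p n] prod_mset_lam[of p n sym_R]
      by (simp add: R_part_def)
  qed
  also have "\<dots> = (\<Sum>(p, \<sigma>)\<in>(SIGMA p:?A. {\<sigma>. (p, \<sigma>) \<in> Gar n}). R_part (lam p))"
  proof (rule sum.Sigma)
    show "\<forall>p\<in>?A. finite {\<sigma>. (p, \<sigma>) \<in> Gar n}"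
    proof
      fix p
      have "{\<sigma>. (p, \<sigma>) \<in> Gar n} = snd ` (Gar n \<inter> {p} \<times> UNIV)" by force
      then show "finite {\<sigma>. (p, \<sigma>) \<in> Gar n}" by (simp add: finite_Gar)
    qed
  qed (simp add: finite_Pf)
  also have "(SIGMA p:?A. {\<sigma>. (p, \<sigma>) \<in> Gar n}) = Gar n"
    by (auto simp: Gar_def naive_shifted_pf_def)
  finally show ?thesis .
qed

end
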